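(* Let $\mathcal{H}$ be a Hilbert space with $\dim\mathcal{H}\ge 3$, and let $\Phi\colon\mathcal{K}(\mathcal{H})\to\mathcal{K}(\mathcal{H})$ be a bijection (not assumed linear). Then $\Phi$ is a strong BJ isomorphism if and only if there exists a unitary or anti-unitary operator $U$ on $\mathcal{H}$ such that $M_{|\Phi(A)^*|}=U(M_{|A^*|})$ and $\ker|\Phi(A)^*|=U(\ker|A^*|)$ for each $A\in\mathcal{K}(\mathcal{H})$.
   Context: $\mathcal{H}$ is a complex Hilbert space and $\mathcal{K}(\mathcal{H})$ is the $C^*$-algebra of compact operators on $\mathcal{H}$. $|A|=(A^*A)^{1/2}$. For a bounded operator $A$, $M_A=\{\xi\in\mathcal{H}:\|A\xi\|=\|A\|\,\|\xi\|\}$ (so $M_0=\mathcal{H}$). An anti-unitary operator is a conjugate-linear bijection $U\colon\mathcal{H}\to\mathcal{H}$ with $\|Ux\|=\|x\|$ for every $x$. For elements $x,y$ of a $C^*$-algebra $\mathfrak{A}$, $x\perp_{BJ}^s y$ means $\|x+yz\|\ge\|x\|$ for each $z\in\mathfrak{A}$. A map $\Phi\colon\mathfrak{A}\to\mathfrak{B}$ between $C^*$-algebras is a strong BJ isomorphism if it is bijective and, for all $x,y$, $x\perp_{BJ}^s y$ if and only if $\Phi(x)\perp_{BJ}^s\Phi(y)$. *)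

theory Defs
  imports "HOL-Analysis.Analysis"
begin

text \<open>
  Complex Hilbert spaces, built on top of the real inner product spaces of HOL-Analysis: the real
  structure underlying a complex inner product space is the one given by the real part of the
  inner product. The complex inner product is conjugate-linear in its first argument.
  Definiteness of \<open>cinner\<close> and \<open>norm x = sqrt (cinner x x)\<close> follow from the axioms of
  \<^class>\<open>real_inner\<close>, see \<open>cinner_self\<close> below.
\<close>

class complex_inner = real_inner +
  fixes scaleC :: "complex \<Rightarrow> 'a \<Rightarrow> 'a" (infixr \<open>*\<^sub>C\<close> 75)
    and cinner :: "'a \<Rightarrow> 'a \<Rightarrow> complex"
  assumes scaleC_add_right: "a *\<^sub>C (x + y) = a *\<^sub>C x + a *\<^sub>C y"
    and scaleC_add_left: "(a + b) *\<^sub>C x = a *\<^sub>C x + b *\<^sub>C x"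
    and scaleC_scaleC: "a *\<^sub>C b *\<^sub>C x = (a * b) *\<^sub>C x"
    and scaleC_one: "1 *\<^sub>C x = x"
    and scaleR_eq_scaleC: "r *\<^sub>R x = complex_of_real r *\<^sub>C x"
    and cinner_commute: "cinner x y = cnj (cinner y x)"
    and cinner_add_right: "cinner x (y + z) = cinner x y + cinner x z"
    and cinner_scaleC_right: "cinner x (a *\<^sub>C y) = a * cinner x y"
    and inner_eq_Re_cinner: "inner x y = Re (cinner x y)"

class chilbert_space = complex_inner + complete_space

lemma cinner_self: "cinner x x = complex_of_real ((norm x)\<^sup>2)"
proof -
  have "Im (cinner x x) = 0"
    using arg_cong[OF cinner_commute[of x x], of Im] by simp
  then show ?thesis
    by (simp add: complex_eq_iff dot_square_norm flip: inner_eq_Re_cinner)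
qed

global_interpretation complex_vector:
  vector_space "scaleC :: complex \<Rightarrow> 'a \<Rightarrow> 'a::complex_inner"
  by unfold_locales (simp_all add: scaleC_add_right scaleC_add_left scaleC_scaleC scaleC_one)

abbreviation clinear :: "('a::complex_inner \<Rightarrow> 'b::complex_inner) \<Rightarrow> bool" where
  "clinear \<equiv> Vector_Spaces.linear scaleC scaleC"

definition conj_linear :: "('a::complex_inner \<Rightarrow> 'b::complex_inner) \<Rightarrow> bool" where
  "conj_linear f \<longleftrightarrow>
     (\<forall>x y. f (x + y) = f x + f y) \<and> (\<forall>a x. f (a *\<^sub>C x) = cnj a *\<^sub>C f x)"

definition unitary_op :: "('a::complex_inner \<Rightarrow> 'a) \<Rightarrow> bool" where
  "unitary_op U \<longleftrightarrow> clinear U \<and> bij U \<and> (\<forall>x y. cinner (U x) (U y) = cinner x y)"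

definition antiunitary_op :: "('a::complex_inner \<Rightarrow> 'a) \<Rightarrow> bool" where
  "antiunitary_op U \<longleftrightarrow> conj_linear U \<and> bij U \<and> (\<forall>x. norm (U x) = norm x)"

text \<open>
  Elements of the type \<open>'a \<Rightarrow>\<^sub>L 'a\<close> are only real-linear, so complex linearity is imposed
  through the following sets. The norm of \<open>'a \<Rightarrow>\<^sub>L 'a\<close> is the operator norm.
\<close>

definition bounded_ops :: "('a::complex_inner \<Rightarrow>\<^sub>L 'a) set" where
  "bounded_ops = {A. clinear (blinfun_apply A)}"

definition compact_ops :: "('a::complex_inner \<Rightarrow>\<^sub>L 'a) set" where
  "compact_ops = {A \<in> bounded_ops. compact (closure (blinfun_apply A ` cball 0 1))}"

definition adj_op :: "('a::complex_inner \<Rightarrow>\<^sub>L 'a) \<Rightarrow> ('a \<Rightarrow>\<^sub>L 'a)" where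
  "adj_op A = (THE B. B \<in> bounded_ops \<and> (\<forall>x y. cinner (A x) y = cinner x (B y)))"

definition positive_op :: "('a::complex_inner \<Rightarrow>\<^sub>L 'a) \<Rightarrow> bool" where
  "positive_op A \<longleftrightarrow> A \<in> bounded_ops \<and> (\<forall>x. cinner x (A x) \<in> \<real>\<^sub>\<ge>\<^sub>0)"

definition sqrt_op :: "('a::complex_inner \<Rightarrow>\<^sub>L 'a) \<Rightarrow> ('a \<Rightarrow>\<^sub>L 'a)" where
  "sqrt_op A = (THE B. positive_op B \<and> B o\<^sub>L B = A)"

definition abs_op :: "('a::complex_inner \<Rightarrow>\<^sub>L 'a) \<Rightarrow> ('a \<Rightarrow>\<^sub>L 'a)" where
  "abs_op A = sqrt_op (adj_op A o\<^sub>L A)"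

definition norm_attaining :: "('a::complex_inner \<Rightarrow>\<^sub>L 'a) \<Rightarrow> 'a set" where
  "norm_attaining A = {\<xi>. norm (A \<xi>) = norm A * norm \<xi>}"

definition ker_op :: "('a::complex_inner \<Rightarrow>\<^sub>L 'a) \<Rightarrow> 'a set" where
  "ker_op A = {\<xi>. A \<xi> = 0}"

text \<open>
  Strong Birkhoff-James orthogonality in a C*-algebra \<open>\<AA>\<close> of operators on a Hilbert space;
  the test elements \<open>z\<close> range over \<open>\<AA>\<close> only, not over all bounded operators.
\<close>

definition strong_BJ ::
  "('a::complex_inner \<Rightarrow>\<^sub>L 'a) set \<Rightarrow> ('a \<Rightarrow>\<^sub>L 'a) \<Rightarrow> ('a \<Rightarrow>\<^sub>L 'a) \<Rightarrow> bool" where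
  "strong_BJ \<AA> x y \<longleftrightarrow> (\<forall>z\<in>\<AA>. norm (x + (y o\<^sub>L z)) \<ge> norm x)"

definition strong_BJ_isomorphism ::
  "('a::complex_inner \<Rightarrow>\<^sub>L 'a) set \<Rightarrow> ('b::complex_inner \<Rightarrow>\<^sub>L 'b) set \<Rightarrow>
   (('a \<Rightarrow>\<^sub>L 'a) \<Rightarrow> ('b \<Rightarrow>\<^sub>L 'b)) \<Rightarrow> bool" where
  "strong_BJ_isomorphism \<AA> \<BB> \<Phi> \<longleftrightarrow>
     bij_betw \<Phi> \<AA> \<BB> \<and>
     (\<forall>x\<in>\<AA>. \<forall>y\<in>\<AA>. strong_BJ \<AA> x y \<longleftrightarrow> strong_BJ \<BB> (\<Phi> x) (\<Phi> y))"

text \<open>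
  The library's \<open>dim\<close> is 0 for infinite-dimensional spaces, so lower bounds on the dimension
  are expressed by the existence of independent vectors.
\<close>

definition cdim_at_least :: "nat \<Rightarrow> 'a::complex_inner itself \<Rightarrow> bool" where
  "cdim_at_least n _ \<longleftrightarrow>
     (\<exists>B::'a set. finite B \<and> card B = n \<and> complex_vector.independent B)"

end

theory Submission
  imports Defs
begin

text \<open>
  For a compact operator \<open>x\<close> let \<open>M(x)\<close> be the set of vectors at which the adjoint of \<open>x\<close> attains its
  norm and \<open>K(x)\<close> the kernel of the adjoint. Since \<open>|x\<^sup>*|\<close> and \<open>x\<^sup>*\<close> have the same norm at every vector,
  these are the two subspaces that the theorem speaks about (\<open>norm_attaining_abs_adj\<close>).

  The link with orthogonality is \<open>strong_BJ_compact_iff\<close>: for compact operators, \<open>x\<close> is strongly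
  orthogonal to \<open>y\<close> iff \<open>x = 0\<close> or \<open>M(x)\<close> and \<open>K(y)\<close> share a nonzero vector. A bijection that
  transports \<open>M\<close> and \<open>K\<close> along one linear or conjugate-linear bijection therefore preserves strong
  orthogonality.

  Conversely, let \<open>\<Phi>\<close> preserve strong orthogonality. The inclusion \<open>K(y) \<subseteq> K(z)\<close> says that everything
  orthogonal to \<open>y\<close> is orthogonal to \<open>z\<close>, so \<open>\<Phi>\<close> respects these inclusions. The operators \<open>y\<close> for
  which \<open>K(y)\<close> is a hyperplane are those with \<open>K(y)\<close> maximal among the proper kernels; hence \<open>\<Phi>\<close>
  permutes hyperplanes, that is, it induces a bijection of the rays of the Hilbert space. This ray
  map preserves orthogonality in both directions and satisfies \<open>\<zeta> \<in> K(y)\<close> iff its image lies in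
  \<open>K(\<Phi> y)\<close>. By Uhlhorn's theorem (\<open>uhlhorn\<close>), in dimension at least 3 it is induced by a unitary or
  anti-unitary \<open>U\<close>, which therefore transports \<open>K\<close>. It also transports \<open>M\<close>, because \<open>M(x)\<close> can be
  recovered from orthogonality and \<open>K\<close> alone: for \<open>x \<noteq> 0\<close>, a nonzero \<open>\<zeta>\<close> lies in \<open>M(x)\<close> iff \<open>x\<close> is
  orthogonal to every \<open>y\<close> with \<open>\<zeta> \<in> K(y)\<close> (\<open>attain_adj_iff_strong_BJ\<close>).

  Uhlhorn's theorem is proved in an affine chart. Fix a unit vector \<open>e\<close> with image \<open>e'\<close>. On rays the
  map has the form \<open>e + x \<mapsto> e' + chart x\<close> for \<open>x \<bottom> e\<close>. Because \<open>e + x \<bottom> e + y\<close> iff \<open>\<langle>x, y\<rangle> = -1\<close>,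
  orthogonality pins down the form \<open>\<langle>chart x, chart y\<rangle>\<close>: it equals \<open>\<sigma> \<langle>x, y\<rangle>\<close> for one function \<open>\<sigma>\<close>
  on the complex numbers, which turns out to be a ring homomorphism commuting with conjugation. Such
  a homomorphism is the identity or the conjugation, and \<open>t e + x \<mapsto> \<sigma> t e' + chart x\<close> is the unitary or
  anti-unitary operator.
\<close>

section \<open>Complex inner product spaces\<close>

lemma cinner_zero_right [simp]: "cinner x 0 = 0"
  using cinner_add_right[of x 0 0] by simp

lemma cinner_zero_left [simp]: "cinner 0 x = 0"
  by (subst cinner_commute) simp

lemma cinner_add_left: "cinner (x + y) z = cinner x z + cinner y z"
  by (metis cinner_add_right cinner_commute complex_cnj_add)

lemma cinner_scaleC_left: "cinner (a *\<^sub>C x) y = cnj a * cinner x y"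
  by (metis cinner_commute cinner_scaleC_right complex_cnj_mult)

lemma cinner_minus_right: "cinner x (- y) = - cinner x y"
  using cinner_add_right[of x y "- y"] by (simp add: add_eq_0_iff)

lemma cinner_minus_left: "cinner (- x) y = - cinner x y"
  using cinner_add_left[of x "- x" y] by (simp add: add_eq_0_iff)

lemma cinner_diff_right: "cinner x (y - z) = cinner x y - cinner x z"
  using cinner_add_right[of x y "- z"] by (simp add: cinner_minus_right)

lemma cinner_diff_left: "cinner (x - y) z = cinner x z - cinner y z"
  using cinner_add_left[of x "- y" z] by (simp add: cinner_minus_left)

lemma cinner_scaleR_right: "cinner x (r *\<^sub>R y) = of_real r * cinner x y"
  by (simp add: scaleR_eq_scaleC cinner_scaleC_right)

lemma cinner_scaleR_left: "cinner (r *\<^sub>R x) y = of_real r * cinner x y"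
  by (simp add: scaleR_eq_scaleC cinner_scaleC_left)

lemmas cinner_simps = cinner_add_left cinner_add_right cinner_diff_left cinner_diff_right
  cinner_minus_left cinner_minus_right cinner_scaleC_left cinner_scaleC_right
  cinner_scaleR_left cinner_scaleR_right

lemma cinner_self_eq_0_iff [simp]: "cinner x x = 0 \<longleftrightarrow> x = 0"
  by (simp add: cinner_self)

lemma cinner_eq_0_commute: "cinner x y = 0 \<longleftrightarrow> cinner y x = 0"
  by (metis cinner_commute complex_cnj_zero)

lemma cinner_ext: "(\<And>x. cinner x y = cinner x z) \<Longrightarrow> y = z"
  using cinner_self_eq_0_iff[of "y - z"] by (simp add: cinner_diff_right del: cinner_self_eq_0_iff)

lemma norm_scaleC: "norm (a *\<^sub>C x) = cmod a * norm (x::'a::complex_inner)"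
proof -
  have "cinner (a *\<^sub>C x) (a *\<^sub>C x) = a * cnj a * cinner x x"
    by (simp add: cinner_scaleC_left cinner_scaleC_right)
  then have "complex_of_real ((norm (a *\<^sub>C x))\<^sup>2) = complex_of_real ((cmod a * norm x)\<^sup>2)"
    unfolding cinner_self power_mult_distrib of_real_mult complex_norm_square .
  then show ?thesis
    by (simp only: of_real_eq_iff power2_eq_iff_nonneg norm_ge_zero mult_nonneg_nonneg)
qed

text \<open>
  The imaginary part of \<open>cinner\<close> is again a value of \<open>inner\<close>, so identities that a complex-linear
  operator satisfies for \<open>inner\<close> hold for \<open>cinner\<close> as well.
\<close>

lemma cinner_eq_inner: "cinner x y = Complex (inner x y) (- inner x (\<i> *\<^sub>C y))"
  by (simp add: complex_eq_iff inner_eq_Re_cinner cinner_scaleC_right)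

text \<open>
  Multiplying \<open>y\<close> by the phase that makes the inner product a nonnegative real reduces this to the
  Cauchy-Schwarz inequality for \<open>inner\<close>.
\<close>

lemma cmod_cinner_le: "cmod (cinner x y) \<le> norm x * norm (y::'a::complex_inner)"
proof (cases "cinner x y = 0")
  case False
  define u where "u = cnj (cinner x y) / cmod (cinner x y)"
  have "u * cinner x y = cmod (cinner x y)"
    using False complex_norm_square[of "cinner x y"]
    by (simp add: u_def power2_eq_square divide_eq_eq mult.commute)
  then have "cmod (cinner x y) = inner x (u *\<^sub>C y)"
    by (simp add: inner_eq_Re_cinner cinner_scaleC_right)
  also have "\<dots> \<le> norm x * norm (u *\<^sub>C y)"
    by (rule norm_cauchy_schwarz)
  also have "\<dots> = norm x * norm y"
    using False by (simp add: norm_scaleC u_def norm_divide)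
  finally show ?thesis .
qed simp

lemma orthogonal_decomposition:
  fixes x y :: "'a::complex_inner"
  obtains c z where "x = c *\<^sub>C y + z" "cinner y z = 0"
proof
  \<comment> \<open>For \<open>y = 0\<close> the coefficient is \<open>0 / 0 = 0\<close>, which is the right value.\<close>
  show "x = (cinner y x / cinner y y) *\<^sub>C y + (x - (cinner y x / cinner y y) *\<^sub>C y)"
    by simp
  show "cinner y (x - (cinner y x / cinner y y) *\<^sub>C y) = 0"
    by (cases "y = 0") (simp_all add: cinner_simps)
qed

lemma orthogonal_decomposition2:
  fixes x a b :: "'a::complex_inner"
  obtains \<alpha> \<beta> z where "x = \<alpha> *\<^sub>C a + \<beta> *\<^sub>C b + z" "cinner a z = 0" "cinner b z = 0"
proof -
  obtain \<alpha> x' where x': "x = \<alpha> *\<^sub>C a + x'" "cinner a x' = 0"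
    by (rule orthogonal_decomposition)
  obtain \<gamma> b' where b': "b = \<gamma> *\<^sub>C a + b'" "cinner a b' = 0"
    by (rule orthogonal_decomposition)
  obtain \<beta> z where z: "x' = \<beta> *\<^sub>C b' + z" "cinner b' z = 0"
    by (rule orthogonal_decomposition)
  have az: "cinner a z = 0"
    using x'(2) b'(2) z(1) by (simp add: cinner_simps)
  show thesis
  proof
    show "x = (\<alpha> - \<beta> * \<gamma>) *\<^sub>C a + \<beta> *\<^sub>C b + z"
      unfolding x'(1) z(1) b'(1)
      by (simp add: scaleC_add_right scaleC_scaleC complex_vector.scale_left_diff_distrib)
    show "cinner b z = 0"
      using az z(2) by (simp add: b'(1) cinner_simps)
  qed (rule az)
qed

section \<open>Riesz representation and adjoints\<close>

instance chilbert_space \<subseteq> banach ..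

text \<open>
  The first-variation argument: near \<open>t = 0\<close> the linear term dominates, and a sign change is excluded
  only if its coefficient vanishes.
\<close>

lemma quadratic_nonneg_imp_linear_coeff_zero:
  fixes d N :: real
  assumes nonneg: "\<And>t. 0 \<le> 2 * t * d + t\<^sup>2 * N" and "0 \<le> N"
  shows "d = 0"
proof -
  \<comment> \<open>The minimum is at \<open>- d / N\<close>; the denominator \<open>N + 1\<close> serves \<open>N = 0\<close> as well.\<close>
  from nonneg[of "- d / (N + 1)"] have "0 \<le> - 2 * d\<^sup>2 / (N + 1) + d\<^sup>2 * N / (N + 1)\<^sup>2"
    by (simp add: power2_eq_square)
  then have "0 \<le> (- 2 * d\<^sup>2 / (N + 1) + d\<^sup>2 * N / (N + 1)\<^sup>2) * (N + 1)\<^sup>2"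
    by simp
  also have "\<dots> = - (d\<^sup>2 * (N + 2))"
    using \<open>N \<ge> 0\<close> by (simp add: divide_simps) (simp add: algebra_simps power2_eq_square)
  finally have "d\<^sup>2 * (N + 2) \<le> 0" by simp
  then show ?thesis
    using \<open>N \<ge> 0\<close> by (auto simp: mult_le_0_iff)
qed

text \<open>
  Minimise \<open>|x|\<^sup>2 - 2 f x\<close>. By the parallelogram law a minimising sequence is Cauchy, so completeness
  yields a minimiser \<open>z\<close>; the vanishing of the first variation at \<open>z\<close> in the direction \<open>x\<close> is the claim.
\<close>

theorem riesz_representation:
  fixes f :: "'a::{real_inner, complete_space} \<Rightarrow> real"
  assumes f: "bounded_linear f"
  shows "\<exists>z. \<forall>x. f x = inner z x"
proof -
  interpret bounded_linear f by (rule f)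
  obtain K where K: "\<And>x. \<bar>f x\<bar> \<le> norm x * K"
    using bounded by auto
  define Q where "Q x = (norm x)\<^sup>2 - 2 * f x" for x
  have Q_lower: "- K\<^sup>2 \<le> Q x" for x
  proof -
    have "0 \<le> (norm x - K)\<^sup>2" by simp
    then show ?thesis
      using K[of x] by (simp add: Q_def power2_diff abs_le_iff)
  qed
  define m where "m = (INF x. Q x)"
  have bdd: "bdd_below (range Q)"
    using Q_lower by (intro bdd_belowI2[of _ "- K\<^sup>2"])
  then have m_le: "m \<le> Q x" for x
    unfolding m_def by (intro cINF_lower) auto
  have parallelogram: "(norm (x - y))\<^sup>2 \<le> 2 * (Q x - m) + 2 * (Q y - m)" for x y
  proof -
    have "(norm (x - y))\<^sup>2 = 2 * Q x + 2 * Q y - 4 * Q ((1/2) *\<^sub>R (x + y))"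
      by (simp add: Q_def scaleR add power2_norm_eq_inner inner_simps inner_commute field_simps)
    with m_le[of "(1/2) *\<^sub>R (x + y)"] show ?thesis by simp
  qed
  define r where "r n = 1 / real (Suc n)" for n
  have r_lim: "r \<longlonglongrightarrow> 0"
    unfolding r_def using LIMSEQ_inverse_real_of_nat by (simp add: inverse_eq_divide)
  have "\<exists>x. Q x < m + r n" for n
    using cINF_less_iff[of UNIV Q "m + r n"] bdd by (auto simp: m_def r_def)
  then obtain X where X: "\<And>n. Q (X n) < m + r n" by metis
  have "Cauchy X"
  proof (rule metric_CauchyI)
    fix e :: real assume e: "0 < e"
    obtain N where N: "4 * r N < e\<^sup>2"
      using nat_approx_posE[of "e\<^sup>2 / 4"] e by (auto simp: r_def)
    have "dist (X i) (X j) < e" if "i \<ge> N" "j \<ge> N" for i j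
    proof -
      have "r i \<le> r N" "r j \<le> r N"
        using that by (auto intro!: frac_le simp: r_def)
      then have "Q (X i) - m < r N" "Q (X j) - m < r N"
        using X[of i] X[of j] by linarith+
      then have "(dist (X i) (X j))\<^sup>2 < e\<^sup>2"
        using parallelogram[of "X i" "X j"] N unfolding dist_norm by argo
      then show ?thesis
        using e by (simp add: power2_less_imp_less)
    qed
    then show "\<exists>M. \<forall>i\<ge>M. \<forall>j\<ge>M. dist (X i) (X j) < e" by blast
  qed
  then obtain z where z: "X \<longlonglongrightarrow> z"
    using Cauchy_convergent convergent_def by blast
  have "(\<lambda>n. Q (X n)) \<longlonglongrightarrow> Q z"
    unfolding Q_def by (intro tendsto_intros z tendsto)
  moreover have "(\<lambda>n. m + r n) \<longlonglongrightarrow> m + 0"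
    by (intro tendsto_intros r_lim)
  ultimately have "Q z \<le> m + 0"
    using X by (intro LIMSEQ_le) (auto intro: less_imp_le)
  then have minimal: "Q z \<le> Q x" for x
    using m_le[of x] by simp
  have "f x = inner z x" for x
  proof -
    define d where "d = inner z x - f x"
    define N where "N = (norm x)\<^sup>2"
    have "0 \<le> 2 * t * d + t\<^sup>2 * N" for t
    proof -
      have "Q (z + t *\<^sub>R x) = Q z + 2 * t * d + t\<^sup>2 * N"
        unfolding Q_def d_def N_def power2_norm_eq_inner
        by (simp add: add scaleR inner_simps inner_commute algebra_simps power2_eq_square)
      with minimal[of "z + t *\<^sub>R x"] show ?thesis by simp
    qed
    then have "d = 0"
      by (rule quadratic_nonneg_imp_linear_coeff_zero) (simp add: N_def)
    then show ?thesis by (simp add: d_def)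
  qed
  then show ?thesis by blast
qed

lemma bounded_ops_iff: "A \<in> bounded_ops \<longleftrightarrow> (\<forall>a x. A (a *\<^sub>C x) = a *\<^sub>C A x)"
  by (simp add: bounded_ops_def Vector_Spaces.linear_iff blinfun.bilinear_simps
      complex_vector.vector_space_axioms)

lemma bounded_ops_scaleC: "A \<in> bounded_ops \<Longrightarrow> A (a *\<^sub>C x) = a *\<^sub>C A x"
  by (simp add: bounded_ops_iff)

lemma bounded_ops_compose: "A \<in> bounded_ops \<Longrightarrow> B \<in> bounded_ops \<Longrightarrow> A o\<^sub>L B \<in> bounded_ops"
  by (simp add: bounded_ops_iff)

lemma bounded_ops_diff: "A \<in> bounded_ops \<Longrightarrow> B \<in> bounded_ops \<Longrightarrow> A - B \<in> bounded_ops"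
  by (simp add: bounded_ops_iff blinfun.bilinear_simps complex_vector.scale_right_diff_distrib)

lemma bounded_ops_add: "A \<in> bounded_ops \<Longrightarrow> B \<in> bounded_ops \<Longrightarrow> A + B \<in> bounded_ops"
  by (simp add: bounded_ops_iff blinfun.bilinear_simps scaleC_add_right)

lemma bounded_ops_scaleR: "A \<in> bounded_ops \<Longrightarrow> r *\<^sub>R A \<in> bounded_ops"
  by (simp add: bounded_ops_iff blinfun.bilinear_simps scaleR_eq_scaleC scaleC_scaleC mult.commute)

lemma bounded_ops_id: "id_blinfun \<in> bounded_ops"
  by (simp add: bounded_ops_iff)

lemma bounded_ops_zero: "0 \<in> bounded_ops"
  by (simp add: bounded_ops_iff)

text \<open>
  Riesz representation of the real functionals \<open>x \<mapsto> inner y (A x)\<close> produces the adjoint with respect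
  to \<open>inner\<close>; complex linearity of \<open>A\<close> upgrades it to \<open>cinner\<close>.
\<close>

lemma adjoint_exists:
  fixes A :: "'a::chilbert_space \<Rightarrow>\<^sub>L 'a"
  assumes A: "A \<in> bounded_ops"
  shows "\<exists>B\<in>bounded_ops. \<forall>x y. cinner (A x) y = cinner x (B y)"
proof -
  have "\<exists>z. \<forall>x. inner y (A x) = inner z x" for y
    by (intro riesz_representation bounded_linear_compose[OF bounded_linear_inner_right]
        blinfun.bounded_linear_right)
  then obtain B where B: "\<And>x y. inner y (A x) = inner (B y) x"
    by metis
  have adj: "cinner (A x) y = cinner x (B y)" for x y
  proof -
    have "cinner y (A x) = cinner (B y) x"
      by (simp add: cinner_eq_inner B A flip: bounded_ops_scaleC)
    then show ?thesis
      by (metis cinner_commute)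
  qed
  have "norm (B y) \<le> norm y * norm A" for y
  proof -
    have "(norm (B y))\<^sup>2 = inner y (A (B y))"
      by (simp add: B power2_norm_eq_inner)
    also have "\<dots> \<le> norm y * (norm A * norm (B y))"
      by (rule order_trans[OF norm_cauchy_schwarz]) (intro mult_left_mono norm_blinfun, simp)
    finally show ?thesis
      by (cases "B y = 0") (auto simp: power2_eq_square)
  qed
  moreover have "B (x + y) = B x + B y" for x y
    by (rule cinner_ext) (simp add: cinner_simps flip: adj)
  moreover have scaleC: "B (a *\<^sub>C y) = a *\<^sub>C B y" for a y
    by (rule cinner_ext) (simp add: cinner_simps flip: adj)
  ultimately have "bounded_linear B"
    by (intro bounded_linear_intro) (auto simp: scaleR_eq_scaleC)
  then show ?thesis
    using adj scaleC by (intro bexI[of _ "Blinfun B"])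
      (auto simp: bounded_ops_iff bounded_linear_Blinfun_apply)
qed

lemma adj_op_eqI:
  fixes A B :: "'a::chilbert_space \<Rightarrow>\<^sub>L 'a"
  assumes "B \<in> bounded_ops" "\<And>x y. cinner (A x) y = cinner x (B y)"
  shows "adj_op A = B"
  unfolding adj_op_def
proof (rule the_equality)
  fix C assume C: "C \<in> bounded_ops \<and> (\<forall>x y. cinner (A x) y = cinner x (C y))"
  show "C = B"
  proof (rule blinfun_eqI, rule cinner_ext)
    fix x y show "cinner x (C y) = cinner x (B y)"
      using C assms(2) by metis
  qed
qed (use assms in blast)

context
  fixes A :: "'a::chilbert_space \<Rightarrow>\<^sub>L 'a"
  assumes A: "A \<in> bounded_ops"
begin

lemma adj_op_bounded: "adj_op A \<in> bounded_ops"
  and cinner_adj_right: "cinner x (adj_op A y) = cinner (A x) y"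
  and cinner_adj_left: "cinner (adj_op A x) y = cinner x (A y)"
proof -
  obtain B where B: "B \<in> bounded_ops" "\<And>x y. cinner (A x) y = cinner x (B y)"
    using adjoint_exists[OF A] by blast
  then have "adj_op A = B" by (rule adj_op_eqI)
  with B show "adj_op A \<in> bounded_ops" "cinner x (adj_op A y) = cinner (A x) y"
    "cinner (adj_op A x) y = cinner x (A y)"
    by (auto, metis cinner_commute)
qed

end

lemma adj_adj:
  fixes A :: "'a::chilbert_space \<Rightarrow>\<^sub>L 'a"
  assumes "A \<in> bounded_ops"
  shows "adj_op (adj_op A) = A"
  by (rule adj_op_eqI) (use assms in \<open>auto simp: cinner_adj_left\<close>)

lemma norm_adj_sq:
  fixes A :: "'a::chilbert_space \<Rightarrow>\<^sub>L 'a"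
  assumes "A \<in> bounded_ops"
  shows "complex_of_real ((norm (adj_op A x))\<^sup>2) = cinner x (A (adj_op A x))"
  unfolding cinner_self[symmetric] by (simp add: cinner_adj_left[OF assms])

lemma norm_adj_le:
  fixes A :: "'a::chilbert_space \<Rightarrow>\<^sub>L 'a"
  assumes A: "A \<in> bounded_ops"
  shows "norm (adj_op A) \<le> norm A"
proof (rule norm_blinfun_bound)
  fix x
  have "(norm (adj_op A x))\<^sup>2 = cmod (cinner x (A (adj_op A x)))"
    using norm_adj_sq[OF A, of x] by (metis norm_of_real abs_of_nonneg zero_le_power2)
  also have "\<dots> \<le> norm x * (norm A * norm (adj_op A x))"
    by (rule order_trans[OF cmod_cinner_le]) (intro mult_left_mono norm_blinfun, simp)
  finally show "norm (adj_op A x) \<le> norm A * norm x"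
    by (cases "adj_op A x = 0") (auto simp: power2_eq_square mult.commute)
qed simp

lemma norm_adj:
  fixes A :: "'a::chilbert_space \<Rightarrow>\<^sub>L 'a"
  assumes A: "A \<in> bounded_ops"
  shows "norm (adj_op A) = norm A"
  using norm_adj_le[OF A] norm_adj_le[OF adj_op_bounded[OF A]] by (simp add: adj_adj A)

section \<open>The square root of \<open>A A\<^sup>*\<close>\<close>

text \<open>
  Writing the square root of \<open>id - T\<close> as \<open>id - Y\<close> turns the equation \<open>(id - Y)\<^sup>2 = id - T\<close> into
  \<open>Y = (T + Y\<^sup>2) / 2\<close>, which is solved by iteration from \<open>0\<close>.
\<close>

fun sqrt_iter :: "('a::complex_inner \<Rightarrow>\<^sub>L 'a) \<Rightarrow> nat \<Rightarrow> ('a \<Rightarrow>\<^sub>L 'a)" where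
  "sqrt_iter T 0 = 0"
| "sqrt_iter T (Suc n) = (1/2) *\<^sub>R (T + (sqrt_iter T n o\<^sub>L sqrt_iter T n))"

text \<open>
  For \<open>T\<close> of norm 1 the iteration need not be a contraction, so convergence comes from a majorant: the
  iterates are polynomials in \<open>T\<close> with nonnegative coefficients, and these are their values at 1.
  They increase and are bounded by 1.
\<close>

fun sqrt_majorant :: "nat \<Rightarrow> real" where
  "sqrt_majorant 0 = 0"
| "sqrt_majorant (Suc n) = (1 + (sqrt_majorant n)\<^sup>2) / 2"

lemma sqrt_majorant_bounds: "0 \<le> sqrt_majorant n" "sqrt_majorant n \<le> 1"
proof (induction n)
  case (Suc n)
  { case 1 show ?case by simp }
  { case 2 show ?case using Suc by (simp add: power_le_one) }
qed auto

lemma sqrt_majorant_mono: "sqrt_majorant n \<le> sqrt_majorant (Suc n)"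
proof -
  have "0 \<le> (1 - sqrt_majorant n)\<^sup>2" by simp
  then show ?thesis by (simp add: power2_diff)
qed

context
  fixes T :: "'a::chilbert_space \<Rightarrow>\<^sub>L 'a"
  assumes T: "norm T \<le> 1"
begin

lemma norm_sqrt_iter_le: "norm (sqrt_iter T n) \<le> sqrt_majorant n"
proof (induction n)
  case (Suc n)
  have "norm (T + (sqrt_iter T n o\<^sub>L sqrt_iter T n))
      \<le> norm T + norm (sqrt_iter T n) * norm (sqrt_iter T n)"
    by (intro order_trans[OF norm_triangle_ineq] add_mono norm_blinfun_compose order_refl)
  also have "\<dots> \<le> 1 + sqrt_majorant n * sqrt_majorant n"
    by (intro add_mono mult_mono T Suc) (auto simp: sqrt_majorant_bounds)
  finally show ?case by (simp add: power2_eq_square)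
qed simp

text \<open>
  The factorisation \<open>A A - B B = A (A - B) + (A - B) B\<close> turns bounds on consecutive iterates and their
  difference into the corresponding difference of squares for the majorant.
\<close>

lemma norm_sqrt_iter_diff_le:
  "norm (sqrt_iter T (Suc n) - sqrt_iter T n) \<le> sqrt_majorant (Suc n) - sqrt_majorant n"
proof (induction n)
  case 0
  show ?case using T by simp
next
  case (Suc n)
  let ?Y = "sqrt_iter T" and ?y = "sqrt_majorant"
  let ?D = "?Y (Suc n) - ?Y n" and ?d = "?y (Suc n) - ?y n"
  have factor: "(1/2) *\<^sub>R (T + (A o\<^sub>L A)) - (1/2) *\<^sub>R (T + (B o\<^sub>L B))
      = (1/2) *\<^sub>R ((A o\<^sub>L (A - B)) + ((A - B) o\<^sub>L B))" for A B :: "'a \<Rightarrow>\<^sub>L 'a"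
    by (rule blinfun_eqI)
      (simp add: blinfun.bilinear_simps scaleR_right_diff_distrib scaleR_add_right)
  have "?Y (Suc (Suc n)) - ?Y (Suc n)
      = (1/2) *\<^sub>R (T + (?Y (Suc n) o\<^sub>L ?Y (Suc n))) - (1/2) *\<^sub>R (T + (?Y n o\<^sub>L ?Y n))"
    by (simp only: sqrt_iter.simps(2))
  also have "\<dots> = (1/2) *\<^sub>R ((?Y (Suc n) o\<^sub>L ?D) + (?D o\<^sub>L ?Y n))"
    by (rule factor)
  also have "norm \<dots> \<le> (1/2) * (norm (?Y (Suc n)) * norm ?D + norm ?D * norm (?Y n))"
    unfolding norm_scaleR
    by (intro mult_mono order_trans[OF norm_triangle_ineq] add_mono norm_blinfun_compose) auto
  also have "\<dots> \<le> (1/2) * (?y (Suc n) * ?d + ?d * ?y n)"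
    using sqrt_majorant_mono[of n]
    by (intro mult_left_mono add_mono mult_mono Suc norm_sqrt_iter_le)
      (auto simp: sqrt_majorant_bounds simp del: sqrt_majorant.simps)
  also have "\<dots> = ?y (Suc (Suc n)) - ?y (Suc n)"
    unfolding sqrt_majorant.simps(2)[of "Suc n"] sqrt_majorant.simps(2)[of n]
    by (simp add: algebra_simps power2_eq_square)
  finally show ?case .
qed

lemma norm_sqrt_iter_tail_le:
  assumes "m \<le> n"
  shows "norm (sqrt_iter T n - sqrt_iter T m) \<le> sqrt_majorant n - sqrt_majorant m"
  using assms
proof (induction n rule: dec_induct)
  case (step n)
  have "norm (sqrt_iter T (Suc n) - sqrt_iter T m)
      \<le> norm (sqrt_iter T (Suc n) - sqrt_iter T n) + norm (sqrt_iter T n - sqrt_iter T m)"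
    using norm_triangle_ineq[of "sqrt_iter T (Suc n) - sqrt_iter T n" "sqrt_iter T n - sqrt_iter T m"]
    by (simp del: sqrt_iter.simps)
  then show ?case
    using step.IH norm_sqrt_iter_diff_le[of n] by linarith
qed simp

lemma sqrt_iter_convergent: "convergent (sqrt_iter T)"
proof (rule Cauchy_convergent, rule metric_CauchyI)
  fix e :: real assume "0 < e"
  have "incseq sqrt_majorant"
    by (intro incseq_SucI sqrt_majorant_mono)
  then have "convergent sqrt_majorant"
    by (rule incseq_convergent[of _ 1]) (auto simp: sqrt_majorant_bounds intro: convergentI)
  then obtain N where N: "\<And>m n. m \<ge> N \<Longrightarrow> n \<ge> N \<Longrightarrow> dist (sqrt_majorant m) (sqrt_majorant n) < e"
    using \<open>0 < e\<close> by (meson convergent_Cauchy metric_CauchyD)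
  have "dist (sqrt_iter T m) (sqrt_iter T n) < e" if "N \<le> m" "N \<le> n" for m n
    using norm_sqrt_iter_tail_le[of m n] norm_sqrt_iter_tail_le[of n m] N[of m n] that
    by (cases "m \<le> n") (auto simp: dist_norm norm_minus_commute)
  then show "\<exists>M. \<forall>m\<ge>M. \<forall>n\<ge>M. dist (sqrt_iter T m) (sqrt_iter T n) < e" by blast
qed

end

lemma cinner_tendsto_right:
  assumes "(f \<longlongrightarrow> l) F"
  shows "((\<lambda>n. cinner x (f n :: 'a::complex_inner)) \<longlongrightarrow> cinner x l) F"
proof -
  have "bounded_linear (cinner x :: 'a \<Rightarrow> complex)"
    by (rule bounded_linear_intro[where K = "norm x"])
      (auto simp: cinner_simps scaleR_conv_of_real mult.commute[of "norm _" "norm x"]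
        intro: cmod_cinner_le)
  then show ?thesis by (rule bounded_linear.tendsto[OF _ assms])
qed

lemma cinner_tendsto_left:
  assumes "(f \<longlongrightarrow> l) F"
  shows "((\<lambda>n. cinner (f n :: 'a::complex_inner) x) \<longlongrightarrow> cinner l x) F"
proof -
  have "bounded_linear (\<lambda>y::'a. cinner y x)"
    by (rule bounded_linear_intro[where K = "norm x"])
      (auto simp: cinner_simps scaleR_conv_of_real intro: cmod_cinner_le)
  then show ?thesis by (rule bounded_linear.tendsto[OF _ assms])
qed

lemma scaleC_tendsto:
  assumes "(f \<longlongrightarrow> l) F"
  shows "((\<lambda>n. a *\<^sub>C (f n :: 'a::complex_inner)) \<longlongrightarrow> a *\<^sub>C l) F"
proof -
  have "bounded_linear (\<lambda>x::'a. a *\<^sub>C x)"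
    by (rule bounded_linear_intro[where K = "cmod a"])
      (auto simp: scaleC_add_right norm_scaleC scaleR_eq_scaleC scaleC_scaleC mult.commute)
  then show ?thesis by (rule bounded_linear.tendsto[OF _ assms])
qed

definition selfadjoint :: "('a::complex_inner \<Rightarrow>\<^sub>L 'a) \<Rightarrow> bool" where
  "selfadjoint A \<longleftrightarrow> (\<forall>x y. cinner (A x) y = cinner x (A y))"

lemma selfadjoint_iter:
  fixes T :: "'a::chilbert_space \<Rightarrow>\<^sub>L 'a"
  assumes "T \<in> bounded_ops" "selfadjoint T"
  shows "sqrt_iter T n \<in> bounded_ops \<and> selfadjoint (sqrt_iter T n)"
  by (induction n) (use assms in \<open>auto simp: selfadjoint_def bounded_ops_zero cinner_simps
      blinfun.bilinear_simps intro!: bounded_ops_add bounded_ops_scaleR bounded_ops_compose\<close>)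

lemma commute_iter:
  assumes "B o\<^sub>L T = T o\<^sub>L B"
  shows "B o\<^sub>L sqrt_iter T n = sqrt_iter T n o\<^sub>L B"
proof (induction n)
  case (Suc n)
  have 1: "B (T x) = T (B x)" for x
    using assms by (metis blinfun_apply_blinfun_compose)
  have 2: "B (sqrt_iter T n x) = sqrt_iter T n (B x)" for x
    using Suc by (metis blinfun_apply_blinfun_compose)
  show ?case
    by (rule blinfun_eqI) (simp add: 1 2 blinfun.bilinear_simps)
qed simp

text \<open>
  The limit \<open>Y\<close> of the iterates has norm at most 1, whence \<open>id - Y\<close> is positive. An operator that
  commutes with \<open>T\<close> commutes with all iterates and so with the limit; this last clause is what
  makes the positive square root unique.
\<close>

lemma sqrt_exists_contraction:
  fixes T :: "'a::chilbert_space \<Rightarrow>\<^sub>L 'a"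
  assumes T: "T \<in> bounded_ops" "selfadjoint T" "norm T \<le> 1"
  shows "\<exists>C. positive_op C \<and> C o\<^sub>L C = id_blinfun - T \<and>
    (\<forall>B. B o\<^sub>L T = T o\<^sub>L B \<longrightarrow> B o\<^sub>L C = C o\<^sub>L B)"
proof -
  obtain Y where Y: "sqrt_iter T \<longlonglongrightarrow> Y"
    using sqrt_iter_convergent[OF T(3)] by (auto simp: convergent_def)
  have Yx: "(\<lambda>n. sqrt_iter T n x) \<longlonglongrightarrow> Y x" for x
    by (intro blinfun.tendsto Y tendsto_const)
  have "norm Y \<le> 1"
    by (rule Lim_bounded[OF tendsto_norm[OF Y]])
      (meson norm_sqrt_iter_le[OF T(3)] sqrt_majorant_bounds order_trans)
  have "(\<lambda>n. sqrt_iter T (Suc n)) \<longlonglongrightarrow> (1/2) *\<^sub>R (T + (Y o\<^sub>L Y))"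
    unfolding sqrt_iter.simps
    by (intro tendsto_intros bounded_bilinear.tendsto[OF bounded_bilinear_blinfun_compose] Y)
  moreover have "(\<lambda>n. sqrt_iter T (Suc n)) \<longlonglongrightarrow> Y"
    using Y by (rule LIMSEQ_Suc)
  ultimately have fixpoint: "Y = (1/2) *\<^sub>R (T + (Y o\<^sub>L Y))"
    using LIMSEQ_unique by blast
  have Y_bounded: "Y \<in> bounded_ops"
    unfolding bounded_ops_iff
  proof (intro allI)
    fix a x
    have "(\<lambda>n. sqrt_iter T n (a *\<^sub>C x)) \<longlonglongrightarrow> a *\<^sub>C Y x"
      using selfadjoint_iter[OF T(1,2)] by (simp add: bounded_ops_scaleC scaleC_tendsto Yx)
    with Yx show "Y (a *\<^sub>C x) = a *\<^sub>C Y x" by (rule LIMSEQ_unique)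
  qed
  have Y_sa: "cinner (Y x) y = cinner x (Y y)" for x y
  proof -
    have "(\<lambda>n. cinner (sqrt_iter T n x) y) \<longlonglongrightarrow> cinner x (Y y)"
      using selfadjoint_iter[OF T(1,2)]
      by (simp add: selfadjoint_def cinner_tendsto_right Yx)
    with cinner_tendsto_left[OF Yx] show ?thesis by (rule LIMSEQ_unique)
  qed
  define C where "C = id_blinfun - Y"
  have C: "C \<in> bounded_ops"
    unfolding C_def by (intro bounded_ops_diff bounded_ops_id Y_bounded)
  have C_sa: "selfadjoint C"
    by (simp add: selfadjoint_def C_def blinfun.bilinear_simps cinner_simps Y_sa)
  have "cinner x (C x) \<in> \<real>\<^sub>\<ge>\<^sub>0" for x
  proof -
    have "cnj (cinner x (C x)) = cinner x (C x)"
      using C_sa by (metis selfadjoint_def cinner_commute)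
    then have "Im (cinner x (C x)) = 0"
      by (metis Reals_cnj_iff complex_is_Real_iff)
    moreover have "inner x (Y x) \<le> norm x * (norm Y * norm x)"
      by (rule order_trans[OF norm_cauchy_schwarz]) (intro mult_left_mono norm_blinfun, simp)
    moreover have "norm x * (norm Y * norm x) \<le> norm x * (1 * norm x)"
      by (intro mult_left_mono mult_right_mono \<open>norm Y \<le> 1\<close>) auto
    ultimately show ?thesis
      by (simp add: complex_nonneg_Reals_iff C_def blinfun.bilinear_simps inner_simps
          power2_norm_eq_inner[symmetric] power2_eq_square flip: inner_eq_Re_cinner)
  qed
  then have "positive_op C"
    using C by (simp add: positive_op_def)
  moreover have "C o\<^sub>L C = id_blinfun - T"
  proof (rule blinfun_eqI)
    fix x
    have "2 *\<^sub>R Y x = T x + Y (Y x)"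
      by (subst fixpoint) (simp add: blinfun.bilinear_simps)
    then show "(C o\<^sub>L C) x = (id_blinfun - T) x"
      by (simp add: C_def blinfun.bilinear_simps scaleR_2 algebra_simps)
  qed
  moreover have "B o\<^sub>L C = C o\<^sub>L B" if "B o\<^sub>L T = T o\<^sub>L B" for B
  proof -
    have "(\<lambda>n. B o\<^sub>L sqrt_iter T n) \<longlonglongrightarrow> (B o\<^sub>L Y)" "(\<lambda>n. sqrt_iter T n o\<^sub>L B) \<longlonglongrightarrow> (Y o\<^sub>L B)"
      by (intro bounded_bilinear.tendsto[OF bounded_bilinear_blinfun_compose] Y tendsto_const)+
    then have BY: "B o\<^sub>L Y = Y o\<^sub>L B"
      using commute_iter[OF that] by (simp add: LIMSEQ_unique)
    have "B (Y x) = Y (B x)" for x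
      using BY by (metis blinfun_apply_blinfun_compose)
    then show ?thesis
      by (intro blinfun_eqI) (simp add: C_def blinfun.bilinear_simps)
  qed
  ultimately show ?thesis by blast
qed

text \<open>
  Polarisation: the quadratic form is real at \<open>x + y\<close> and at \<open>x + \<i> y\<close>.
\<close>

lemma selfadjoint_of_positive:
  assumes "positive_op A"
  shows "selfadjoint A"
proof -
  have A: "A \<in> bounded_ops" and real: "\<And>x. cnj (cinner x (A x)) = cinner x (A x)"
    using assms by (auto simp: positive_op_def complex_nonneg_Reals_iff complex_eq_iff)
  have "cinner (A x) y = cinner x (A y)" for x y
  proof -
    define p q where "p = cinner x (A y)" and "q = cinner y (A x)"
    have "cnj (p + q) = p + q"
      using real[of "x + y"] real[of x] real[of y]
      by (simp add: p_def q_def cinner_simps blinfun.bilinear_simps algebra_simps)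
    moreover have "cnj (\<i> * p - \<i> * q) = \<i> * p - \<i> * q"
      using real[of "x + \<i> *\<^sub>C y"] real[of x] real[of y]
      by (simp add: p_def q_def cinner_simps blinfun.bilinear_simps bounded_ops_scaleC[OF A]
          algebra_simps)
    ultimately have "p = cnj q"
      by (auto simp: complex_eq_iff)
    then show ?thesis
      unfolding p_def q_def using cinner_commute[of "A x" y] by simp
  qed
  then show ?thesis by (simp add: selfadjoint_def)
qed

text \<open>
  Along the line \<open>x + t B x\<close> the form of \<open>B\<close> is a nonnegative quadratic polynomial without constant term,
  and its linear coefficient is twice the square of the norm of \<open>B x\<close>.
\<close>

lemma positive_vanishing_form:
  assumes B: "positive_op B" and "cinner x (B x) = 0"
  shows "B x = 0"
proof -
  note sa = selfadjoint_of_positive[OF B, unfolded selfadjoint_def, rule_format]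
  define N K where "N = (norm (B x))\<^sup>2" and "K = Re (cinner (B x) (B (B x)))"
  have "0 \<le> 2 * t * N + t\<^sup>2 * K" for t :: real
  proof -
    have "0 \<le> Re (cinner (x + t *\<^sub>R B x) (B (x + t *\<^sub>R B x)))"
      using B by (simp add: positive_op_def complex_nonneg_Reals_iff)
    also have "\<dots> = 2 * t * N + t\<^sup>2 * K"
      using assms(2) cinner_self[of "B x"] sa[of x "B x"]
      by (simp add: N_def K_def cinner_simps blinfun.bilinear_simps power2_eq_square algebra_simps)
    finally show ?thesis .
  qed
  then have "N = 0"
    by (rule quadratic_nonneg_imp_linear_coeff_zero)
      (use B in \<open>simp add: K_def positive_op_def complex_nonneg_Reals_iff\<close>)
  then show ?thesis by (simp add: N_def)
qed

text \<open>
  After scaling, \<open>T = id - A A\<^sup>* / |A|\<^sup>2\<close> has norm at most 1, because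
  \<open>|A A\<^sup>* x|\<^sup>2 \<le> |A|\<^sup>2 |A\<^sup>* x|\<^sup>2 = |A|\<^sup>2 \<langle>x, A A\<^sup>* x\<rangle>\<close>.
\<close>

lemma sqrt_of_product_exists:
  fixes A :: "'a::chilbert_space \<Rightarrow>\<^sub>L 'a"
  assumes A: "A \<in> bounded_ops"
  shows "\<exists>C. positive_op C \<and> C o\<^sub>L C = A o\<^sub>L adj_op A \<and>
    (\<forall>B. B o\<^sub>L (A o\<^sub>L adj_op A) = (A o\<^sub>L adj_op A) o\<^sub>L B \<longrightarrow> B o\<^sub>L C = C o\<^sub>L B)"
proof (cases "A = 0")
  case True
  show ?thesis
    unfolding True by (intro exI[of _ 0]) (auto simp: positive_op_def bounded_ops_zero)
next
  case False
  define P where "P = A o\<^sub>L adj_op A"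
  define k where "k = 1 / (norm A)\<^sup>2"
  have "k > 0" using False by (simp add: k_def)
  define T where "T = id_blinfun - k *\<^sub>R P"
  have P: "P \<in> bounded_ops"
    unfolding P_def by (intro bounded_ops_compose adj_op_bounded A)
  have T: "T \<in> bounded_ops"
    unfolding T_def by (intro bounded_ops_diff bounded_ops_id bounded_ops_scaleR P)
  have sa: "selfadjoint T"
    by (simp add: selfadjoint_def T_def P_def cinner_simps blinfun.bilinear_simps
        cinner_adj_right[OF A, symmetric] cinner_adj_left[OF A])
  have "norm T \<le> 1"
  proof (rule norm_blinfun_bound)
    fix x
    have form: "inner x (P x) = (norm (adj_op A x))\<^sup>2"
      unfolding P_def inner_eq_Re_cinner blinfun_apply_blinfun_compose
      using norm_adj_sq[OF A, of x] by (metis Re_complex_of_real)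
    have "(norm (P x))\<^sup>2 \<le> (norm A * norm (adj_op A x))\<^sup>2"
      unfolding P_def by (intro power_mono) (auto intro: norm_blinfun)
    then have "k\<^sup>2 * (norm (P x))\<^sup>2 \<le> k\<^sup>2 * (norm A * norm (adj_op A x))\<^sup>2"
      by (intro mult_left_mono) auto
    also have "\<dots> = k * (norm (adj_op A x))\<^sup>2"
      using False by (simp add: k_def power2_eq_square)
    finally have "k\<^sup>2 * (norm (P x))\<^sup>2 \<le> k * (norm (adj_op A x))\<^sup>2" .
    moreover have "0 \<le> k * (norm (adj_op A x))\<^sup>2"
      using \<open>k > 0\<close> by simp
    moreover have "(norm (T x))\<^sup>2 = (norm x)\<^sup>2 - 2 * (k * (norm (adj_op A x))\<^sup>2) + k\<^sup>2 * (norm (P x))\<^sup>2"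
      unfolding form[symmetric]
      by (simp add: T_def blinfun.bilinear_simps power2_norm_eq_inner inner_simps inner_commute
          algebra_simps) (simp add: power2_eq_square)
    ultimately have "(norm (T x))\<^sup>2 \<le> (norm x)\<^sup>2"
      by linarith
    then show "norm (T x) \<le> 1 * norm x"
      by (simp add: power2_le_iff_abs_le)
  qed simp
  then obtain C where C: "positive_op C" "C o\<^sub>L C = id_blinfun - T"
    "\<And>B. B o\<^sub>L T = T o\<^sub>L B \<Longrightarrow> B o\<^sub>L C = C o\<^sub>L B"
    using sqrt_exists_contraction[OF T sa] by blast
  define D where "D = norm A *\<^sub>R C"
  have CC: "C (C x) = k *\<^sub>R P x" for x
  proof -
    have "(C o\<^sub>L C) x = k *\<^sub>R P x"
      unfolding C(2) by (simp add: T_def blinfun.bilinear_simps)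
    then show ?thesis by simp
  qed
  have "cinner x (D x) \<in> \<real>\<^sub>\<ge>\<^sub>0" for x
    using C(1) by (simp add: D_def blinfun.bilinear_simps cinner_simps positive_op_def
        complex_nonneg_Reals_iff)
  then have "positive_op D"
    using C(1) by (simp add: positive_op_def D_def bounded_ops_scaleR)
  moreover have "D o\<^sub>L D = P"
    using False by (intro blinfun_eqI)
      (simp add: D_def blinfun.bilinear_simps CC k_def power2_eq_square)
  moreover have "B o\<^sub>L D = D o\<^sub>L B" if "B o\<^sub>L P = P o\<^sub>L B" for B
  proof -
    have "B (P x) = P (B x)" for x
      using that by (metis blinfun_apply_blinfun_compose)
    then have "B o\<^sub>L T = T o\<^sub>L B"
      by (intro blinfun_eqI) (simp add: T_def blinfun.bilinear_simps)
    then have "B (C x) = C (B x)" for x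
      using C(3) by (metis blinfun_apply_blinfun_compose)
    then show ?thesis
      by (intro blinfun_eqI) (simp add: D_def blinfun.bilinear_simps)
  qed
  ultimately show ?thesis
    unfolding P_def by blast
qed

text \<open>
  For commuting square roots, \<open>u = (B - C) x\<close> satisfies \<open>(B + C) u = (B\<^sup>2 - C\<^sup>2) x = 0\<close>. Hence both
  nonnegative forms vanish at \<open>u\<close>, so that \<open>B u = C u = 0\<close> and \<open>|u|\<^sup>2 = \<langle>x, (B - C) u\<rangle> = 0\<close>.
\<close>

lemma positive_sqrt_unique:
  assumes B: "positive_op B" and C: "positive_op C"
    and sq: "B o\<^sub>L B = C o\<^sub>L C" and comm: "B o\<^sub>L C = C o\<^sub>L B"
  shows "B = C"
proof (rule blinfun_eqI)
  fix x
  define u where "u = B x - C x"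
  have sq': "B (B x) = C (C x)" and comm': "B (C x) = C (B x)"
    using sq comm by (metis blinfun_apply_blinfun_compose)+
  have "B u + C u = 0"
    by (simp add: u_def blinfun.bilinear_simps sq' comm')
  then have "cinner u (B u) + cinner u (C u) = 0"
    by (metis cinner_add_right cinner_zero_right)
  moreover have "cinner u (B u) \<in> \<real>\<^sub>\<ge>\<^sub>0" "cinner u (C u) \<in> \<real>\<^sub>\<ge>\<^sub>0"
    using B C by (auto simp: positive_op_def)
  ultimately have "cinner u (B u) = 0" "cinner u (C u) = 0"
    by (auto simp: complex_nonneg_Reals_iff complex_eq_iff)
  then have "B u = 0" "C u = 0"
    using B C by (auto intro: positive_vanishing_form)
  moreover have "cinner u u = cinner x (B u) - cinner x (C u)"
    using selfadjoint_of_positive[OF B] selfadjoint_of_positive[OF C]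
    by (simp add: u_def selfadjoint_def cinner_diff_left)
  ultimately show "B x = C x"
    by (simp add: u_def)
qed

lemma abs_adj:
  fixes A :: "'a::chilbert_space \<Rightarrow>\<^sub>L 'a"
  assumes A: "A \<in> bounded_ops"
  shows "positive_op (abs_op (adj_op A))"
    and "abs_op (adj_op A) o\<^sub>L abs_op (adj_op A) = A o\<^sub>L adj_op A"
proof -
  obtain C where C: "positive_op C" "C o\<^sub>L C = A o\<^sub>L adj_op A"
    "\<And>B. B o\<^sub>L (A o\<^sub>L adj_op A) = (A o\<^sub>L adj_op A) o\<^sub>L B \<Longrightarrow> B o\<^sub>L C = C o\<^sub>L B"
    using sqrt_of_product_exists[OF A] by blast
  have "sqrt_op (A o\<^sub>L adj_op A) = C"
    unfolding sqrt_op_def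
  proof (rule the_equality)
    fix B assume B: "positive_op B \<and> B o\<^sub>L B = A o\<^sub>L adj_op A"
    then have sq: "A o\<^sub>L adj_op A = B o\<^sub>L B" by simp
    have "B o\<^sub>L (B o\<^sub>L B) = (B o\<^sub>L B) o\<^sub>L B"
      by (rule blinfun_eqI) simp
    then have "B o\<^sub>L C = C o\<^sub>L B"
      by (intro C(3)) (simp only: sq)
    then show "B = C"
      by (intro positive_sqrt_unique[of B C]) (use B C(1) in \<open>simp_all only: C(2) sq\<close>)
  qed (use C in blast)
  then have "abs_op (adj_op A) = C"
    by (simp add: abs_op_def adj_adj[OF A])
  with C(1,2) show "positive_op (abs_op (adj_op A))"
    "abs_op (adj_op A) o\<^sub>L abs_op (adj_op A) = A o\<^sub>L adj_op A"
    by simp_all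
qed

text \<open>
  The quadratic forms of \<open>|A\<^sup>*|\<^sup>2\<close> and of \<open>A A\<^sup>*\<close> agree. Norm-attaining vectors and kernel depend only on
  the norms of the values, so this lets the adjoint replace its absolute value throughout.
\<close>

lemma norm_abs_adj_apply:
  fixes A :: "'a::chilbert_space \<Rightarrow>\<^sub>L 'a"
  assumes A: "A \<in> bounded_ops"
  shows "norm (abs_op (adj_op A) x) = norm (adj_op A x)"
proof -
  let ?R = "abs_op (adj_op A)"
  have "?R (?R x) = A (adj_op A x)"
    using abs_adj(2)[OF A] by (metis blinfun_apply_blinfun_compose)
  moreover have "cinner (?R x) (?R x) = cinner x (?R (?R x))"
    using selfadjoint_of_positive[OF abs_adj(1)[OF A]] by (simp add: selfadjoint_def)
  ultimately have "complex_of_real ((norm (?R x))\<^sup>2) = complex_of_real ((norm (adj_op A x))\<^sup>2)"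
    by (simp only: cinner_self[symmetric] cinner_adj_left[OF A])
  then show ?thesis
    by (simp only: of_real_eq_iff power2_eq_iff_nonneg norm_ge_zero)
qed

lemma norm_attaining_abs_adj:
  fixes A :: "'a::chilbert_space \<Rightarrow>\<^sub>L 'a"
  assumes "A \<in> bounded_ops"
  shows "norm_attaining (abs_op (adj_op A)) = norm_attaining (adj_op A)"
    and "ker_op (abs_op (adj_op A)) = ker_op (adj_op A)"
proof -
  have "norm (abs_op (adj_op A)) = norm (adj_op A)"
  proof (rule antisym)
    show "norm (abs_op (adj_op A)) \<le> norm (adj_op A)"
      by (rule norm_blinfun_bound) (simp_all add: norm_abs_adj_apply[OF assms] norm_blinfun)
    show "norm (adj_op A) \<le> norm (abs_op (adj_op A))"
      by (rule norm_blinfun_bound) (simp_all add: norm_blinfun flip: norm_abs_adj_apply[OF assms])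
  qed
  then show "norm_attaining (abs_op (adj_op A)) = norm_attaining (adj_op A)"
    by (simp add: norm_attaining_def norm_abs_adj_apply[OF assms])
  have "abs_op (adj_op A) x = 0 \<longleftrightarrow> adj_op A x = 0" for x
    by (metis norm_abs_adj_apply[OF assms] norm_eq_zero)
  then show "ker_op (abs_op (adj_op A)) = ker_op (adj_op A)"
    by (simp add: ker_op_def)
qed

section \<open>Compact operators\<close>

lemma compact_ops_bounded: "A \<in> compact_ops \<Longrightarrow> A \<in> bounded_ops"
  by (simp add: compact_ops_def)

lemma compact_opsI:
  assumes "A \<in> bounded_ops" "compact K" "A ` cball 0 1 \<subseteq> K"
  shows "A \<in> compact_ops"
proof -
  have "closure (A ` cball 0 1) \<subseteq> K"
    using assms by (intro closure_minimal compact_imp_closed)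
  then have "compact (closure (A ` cball 0 1))"
    using assms(2) closed_closure by (metis compact_Int_closed inf.absorb_iff2)
  with assms(1) show ?thesis by (simp add: compact_ops_def)
qed

lemma compact_ops_compose_left:
  assumes "B \<in> bounded_ops" "A \<in> compact_ops"
  shows "B o\<^sub>L A \<in> compact_ops"
proof (rule compact_opsI)
  show "B o\<^sub>L A \<in> bounded_ops"
    by (intro bounded_ops_compose assms(1) compact_ops_bounded[OF assms(2)])
  show "compact (B ` closure (A ` cball 0 1))"
    using assms(2) by (intro compact_continuous_image linear_continuous_on blinfun.bounded_linear_right)
      (simp add: compact_ops_def)
  show "(B o\<^sub>L A) ` cball 0 1 \<subseteq> B ` closure (A ` cball 0 1)"
    using closure_subset by fastforce
qed

lemma zero_in_compact_ops: "0 \<in> compact_ops"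
  by (rule compact_opsI[where K = "{0}"]) (auto simp: bounded_ops_zero)

lift_definition rank_one :: "'a::complex_inner \<Rightarrow> 'a \<Rightarrow> ('a \<Rightarrow>\<^sub>L 'a)" is
  "\<lambda>u v x. cinner v x *\<^sub>C u"
proof (rule bounded_linear_intro)
  fix u v x y :: 'a and r :: real
  show "cinner v (x + y) *\<^sub>C u = cinner v x *\<^sub>C u + cinner v y *\<^sub>C u"
    by (simp add: cinner_simps scaleC_add_left)
  show "cinner v (r *\<^sub>R x) *\<^sub>C u = r *\<^sub>R cinner v x *\<^sub>C u"
    by (simp add: cinner_simps scaleR_eq_scaleC scaleC_scaleC)
  have "cmod (cinner v x) * norm u \<le> (norm v * norm x) * norm u"
    by (intro mult_right_mono cmod_cinner_le) simp
  then show "norm (cinner v x *\<^sub>C u) \<le> norm x * (norm v * norm u)"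
    by (simp add: norm_scaleC mult_ac)
qed

lemma rank_one_bounded: "rank_one u v \<in> bounded_ops"
  by (simp add: bounded_ops_iff rank_one.rep_eq cinner_simps scaleC_scaleC)

lemma rank_one_compact: "rank_one u v \<in> compact_ops"
proof (rule compact_opsI[OF rank_one_bounded])
  have "bounded_linear (\<lambda>a. a *\<^sub>C u)"
    by (rule bounded_linear_intro[where K = "norm u"])
      (auto simp: scaleC_add_left norm_scaleC scaleR_eq_scaleC scaleC_scaleC scaleR_conv_of_real)
  then show "compact ((\<lambda>a. a *\<^sub>C u) ` cball 0 (norm v))"
    by (intro compact_continuous_image linear_continuous_on) auto
  have "cmod (cinner v x) \<le> norm v" if "norm x \<le> 1" for x
    using cmod_cinner_le[of v x] mult_left_le[OF that, of "norm v"] by simp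
  then show "rank_one u v ` cball 0 1 \<subseteq> (\<lambda>a. a *\<^sub>C u) ` cball 0 (norm v)"
    by (auto simp: rank_one.rep_eq)
qed

text \<open>
  A vector at which \<open>A\<close> attains its norm is an eigenvector of \<open>A\<^sup>* A\<close> for the top eigenvalue. The
  quantitative form says that near-maximisers are approximate eigenvectors, which is what
  compactness arguments need.
\<close>

lemma norm_eigen_defect_le:
  fixes A :: "'a::chilbert_space \<Rightarrow>\<^sub>L 'a"
  assumes A: "A \<in> bounded_ops"
  shows "(norm (adj_op A (A v) - (norm A)\<^sup>2 *\<^sub>R v))\<^sup>2
    \<le> (norm A)\<^sup>2 * ((norm A)\<^sup>2 * (norm v)\<^sup>2 - (norm (A v))\<^sup>2)"
proof -
  define s where "s = (norm A)\<^sup>2"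
  have "inner v (adj_op A (A v)) = inner (A v) (A v)"
    by (simp add: inner_eq_Re_cinner cinner_adj_right[OF A])
  then have "(norm (adj_op A (A v) - s *\<^sub>R v))\<^sup>2
      = (norm (adj_op A (A v)))\<^sup>2 - 2 * s * (norm (A v))\<^sup>2 + s\<^sup>2 * (norm v)\<^sup>2"
    unfolding power2_norm_eq_inner
    by (simp add: inner_simps inner_commute algebra_simps power2_eq_square)
  moreover have "(norm (adj_op A (A v)))\<^sup>2 \<le> s * (norm (A v))\<^sup>2"
    using power_mono[OF norm_blinfun[of "adj_op A" "A v"], of 2]
    by (simp add: norm_adj[OF A] s_def power_mult_distrib)
  ultimately show ?thesis
    unfolding s_def[symmetric] by (simp add: algebra_simps power2_eq_square[of s])
qed

lemma norm_attaining_iff_eigen: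
  fixes A :: "'a::chilbert_space \<Rightarrow>\<^sub>L 'a"
  assumes A: "A \<in> bounded_ops"
  shows "v \<in> norm_attaining A \<longleftrightarrow> adj_op A (A v) = (norm A)\<^sup>2 *\<^sub>R v"
proof
  assume "v \<in> norm_attaining A"
  then have "(norm (A v))\<^sup>2 = (norm A)\<^sup>2 * (norm v)\<^sup>2"
    by (simp add: norm_attaining_def power_mult_distrib)
  with norm_eigen_defect_le[OF A, of v] show "adj_op A (A v) = (norm A)\<^sup>2 *\<^sub>R v"
    by simp
next
  assume eq: "adj_op A (A v) = (norm A)\<^sup>2 *\<^sub>R v"
  have "inner (A v) (A v) = inner v (adj_op A (A v))"
    by (simp add: inner_eq_Re_cinner cinner_adj_right[OF A])
  also have "\<dots> = (norm A)\<^sup>2 * inner v v"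
    by (simp add: eq)
  finally have "(norm (A v))\<^sup>2 = (norm A * norm v)\<^sup>2"
    by (simp only: power2_norm_eq_inner[symmetric] power_mult_distrib)
  then show "v \<in> norm_attaining A"
    unfolding norm_attaining_def by (simp only: power2_eq_iff_nonneg norm_ge_zero
        mult_nonneg_nonneg mem_Collect_eq)
qed

text \<open>
  Along a subsequence of near-maximisers \<open>w n\<close> the images \<open>A (w n)\<close> converge, say to \<open>l\<close>. As
  \<open>A\<^sup>* A (w n) - |A|\<^sup>2 w n\<close> tends to 0 by \<open>norm_eigen_defect_le\<close>, the vectors \<open>w n\<close> themselves converge
  in norm, to \<open>A\<^sup>* l / |A|\<^sup>2\<close>, and \<open>A\<close> attains its norm there.
\<close>

lemma compact_attains_norm:
  fixes A :: "'a::chilbert_space \<Rightarrow>\<^sub>L 'a"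
  assumes A: "A \<in> compact_ops" and "A \<noteq> 0"
  shows "\<exists>v\<in>norm_attaining A. v \<noteq> 0"
proof -
  note A' = compact_ops_bounded[OF A]
  define s where "s = (norm A)\<^sup>2"
  have "s > 0" using \<open>A \<noteq> 0\<close> by (simp add: s_def)
  have "\<exists>v. norm v \<le> 1 \<and> norm A - 1 / real (Suc n) < norm (A v)" for n
  proof (rule ccontr)
    define c where "c = norm A - 1 / real (Suc n)"
    assume "\<not> ?thesis"
    then have c: "norm (A v) \<le> c" if "norm v \<le> 1" for v
      using that by (force simp: c_def)
    have "norm A \<le> c"
    proof (rule norm_blinfun_bound)
      show "0 \<le> c" using c[of 0] by simp
      fix x
      show "norm (A x) \<le> c * norm x"
        using c[of "(1 / norm x) *\<^sub>R x"]
        by (cases "x = 0") (auto simp: blinfun.bilinear_simps divide_le_eq)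
    qed
    then show False by (simp add: c_def)
  qed
  then obtain v where v: "\<And>n. norm (v n) \<le> 1" "\<And>n. norm A - 1 / real (Suc n) < norm (A (v n))"
    by metis
  have "A (v n) \<in> closure (A ` cball 0 1)" for n
    using v(1) closure_subset by (fastforce simp: dist_norm)
  moreover have "compact (closure (A ` cball 0 1))"
    using A by (simp add: compact_ops_def)
  ultimately obtain l r where r: "strict_mono r" and lim: "((\<lambda>n. A (v n)) \<circ> r) \<longlonglongrightarrow> l"
    unfolding compact_def by meson
  define w where "w n = v (r n)" for n
  have Aw: "(\<lambda>n. A (w n)) \<longlonglongrightarrow> l"
    using lim by (simp add: w_def o_def)
  have w_le: "norm (w n) \<le> 1" for n
    by (simp add: w_def v)
  have norm_Aw: "(\<lambda>n. norm (A (w n))) \<longlonglongrightarrow> norm A"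
  proof (rule tendsto_sandwich)
    have "(\<lambda>n. norm A - 1 / real (Suc n)) \<longlonglongrightarrow> norm A - 0"
      using LIMSEQ_inverse_real_of_nat by (intro tendsto_intros) (simp add: inverse_eq_divide)
    then show "(\<lambda>n. norm A - 1 / real (Suc (r n))) \<longlonglongrightarrow> norm A"
      using LIMSEQ_subseq_LIMSEQ[OF _ r] by (fastforce simp: o_def)
    show "\<forall>\<^sub>F n in sequentially. norm A - 1 / real (Suc (r n)) \<le> norm (A (w n))"
      using v(2) by (auto simp: w_def intro!: always_eventually less_imp_le)
    have "norm (A (w n)) \<le> norm A" for n
      by (rule order_trans[OF norm_blinfun]) (simp add: mult_left_le w_le)
    then show "\<forall>\<^sub>F n in sequentially. norm (A (w n)) \<le> norm A"
      by simp
  qed simp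
  then have norm_l: "norm l = norm A"
    using LIMSEQ_unique tendsto_norm[OF Aw] by blast
  have defect: "(\<lambda>n. adj_op A (A (w n)) - s *\<^sub>R w n) \<longlonglongrightarrow> 0"
  proof (rule Lim_null_comparison)
    have "(\<lambda>n. sqrt (s * (s - (norm (A (w n)))\<^sup>2))) \<longlonglongrightarrow> sqrt (s * (s - (norm A)\<^sup>2))"
      by (intro tendsto_intros norm_Aw)
    then show "(\<lambda>n. sqrt (s * (s - (norm (A (w n)))\<^sup>2))) \<longlonglongrightarrow> 0"
      by (simp add: s_def)
    have "(norm (adj_op A (A (w n)) - s *\<^sub>R w n))\<^sup>2 \<le> s * (s - (norm (A (w n)))\<^sup>2)" for n
    proof -
      have "s * (norm (w n))\<^sup>2 \<le> s"
        using \<open>s > 0\<close> by (simp add: mult_left_le power_le_one w_le)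
      then have "s * (s * (norm (w n))\<^sup>2 - (norm (A (w n)))\<^sup>2) \<le> s * (s - (norm (A (w n)))\<^sup>2)"
        using \<open>s > 0\<close> by (intro mult_left_mono) auto
      then show ?thesis
        using norm_eigen_defect_le[OF A', of "w n"] by (simp add: s_def)
    qed
    then show "\<forall>\<^sub>F n in sequentially. norm (adj_op A (A (w n)) - s *\<^sub>R w n)
        \<le> sqrt (s * (s - (norm (A (w n)))\<^sup>2))"
      by (simp add: real_le_rsqrt)
  qed
  define u where "u = (1 / s) *\<^sub>R adj_op A l"
  have "(\<lambda>n. (1 / s) *\<^sub>R (adj_op A (A (w n)) - (adj_op A (A (w n)) - s *\<^sub>R w n)))
      \<longlonglongrightarrow> (1 / s) *\<^sub>R (adj_op A l - 0)"
    by (intro tendsto_intros defect blinfun.tendsto Aw)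
  then have w: "w \<longlonglongrightarrow> u"
    using \<open>s > 0\<close> by (simp add: u_def)
  have "norm u \<le> 1"
    by (rule Lim_bounded[OF tendsto_norm[OF w]]) (simp add: w_le)
  have "(\<lambda>n. A (w n)) \<longlonglongrightarrow> A u"
    by (intro blinfun.tendsto tendsto_const w)
  then have "A u = l"
    using Aw LIMSEQ_unique by blast
  have "norm A * norm u \<le> norm A * 1"
    by (intro mult_left_mono \<open>norm u \<le> 1\<close>) auto
  then have "norm (A u) = norm A * norm u"
    using norm_blinfun[of A u] by (simp add: \<open>A u = l\<close> norm_l)
  moreover have "u \<noteq> 0"
    using \<open>A u = l\<close> norm_l \<open>A \<noteq> 0\<close> by auto
  ultimately show ?thesis
    by (auto simp: norm_attaining_def)
qed

section \<open>Strong orthogonality in terms of two subspaces\<close>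

text \<open>
  The subspaces \<open>M(x)\<close> and \<open>K(x)\<close> of the introduction.
\<close>

abbreviation attain_adj :: "('a::complex_inner \<Rightarrow>\<^sub>L 'a) \<Rightarrow> 'a set" where
  "attain_adj x \<equiv> norm_attaining (adj_op x)"

abbreviation ker_adj :: "('a::complex_inner \<Rightarrow>\<^sub>L 'a) \<Rightarrow> 'a set" where
  "ker_adj x \<equiv> ker_op (adj_op x)"

lemma ker_adj_iff:
  fixes y :: "'a::chilbert_space \<Rightarrow>\<^sub>L 'a"
  assumes y: "y \<in> bounded_ops"
  shows "\<xi> \<in> ker_adj y \<longleftrightarrow> (\<forall>u. cinner (y u) \<xi> = 0)"
proof
  assume "\<forall>u. cinner (y u) \<xi> = 0"
  then have "cinner (adj_op y \<xi>) (adj_op y \<xi>) = 0"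
    by (simp add: cinner_adj_right[OF y])
  then show "\<xi> \<in> ker_adj y"
    by (simp add: ker_op_def)
qed (simp add: ker_op_def flip: cinner_adj_right[OF y])

lemma attain_adj_iff:
  fixes x :: "'a::chilbert_space \<Rightarrow>\<^sub>L 'a"
  assumes x: "x \<in> bounded_ops"
  shows "\<xi> \<in> attain_adj x \<longleftrightarrow> x (adj_op x \<xi>) = (norm x)\<^sup>2 *\<^sub>R \<xi>"
  using norm_attaining_iff_eigen[OF adj_op_bounded[OF x]] by (simp add: adj_adj[OF x] norm_adj[OF x])

lemma attain_adj_image:
  fixes x :: "'a::chilbert_space \<Rightarrow>\<^sub>L 'a"
  assumes x: "x \<in> bounded_ops" and v: "v \<in> norm_attaining x"
  shows "x v \<in> attain_adj x"
  using v norm_attaining_iff_eigen[OF x, of v]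
  by (simp add: attain_adj_iff[OF x] blinfun.bilinear_simps)

text \<open>
  Since \<open>y\<^sup>* \<xi> = 0\<close>, the number \<open>\<langle>(x + y z) x\<^sup>* \<xi>, \<xi>\<rangle> = |x\<^sup>* \<xi>|\<^sup>2\<close> does not depend on \<open>z\<close>, and
  Cauchy-Schwarz bounds \<open>x + y z\<close> from below by it.
\<close>

lemma strong_BJ_if_attain_ker:
  fixes x y :: "'a::chilbert_space \<Rightarrow>\<^sub>L 'a"
  assumes x: "x \<in> bounded_ops" and y: "y \<in> bounded_ops"
    and \<xi>: "\<xi> \<noteq> 0" "\<xi> \<in> attain_adj x" "\<xi> \<in> ker_adj y"
  shows "strong_BJ \<AA> x y"
  unfolding strong_BJ_def
proof
  fix z
  let ?w = "x + (y o\<^sub>L z)"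
  have norm_eq: "norm (adj_op x \<xi>) = norm x * norm \<xi>"
    using \<xi>(2) by (simp add: norm_attaining_def norm_adj[OF x])
  have "cinner (y (z (adj_op x \<xi>))) \<xi> = 0"
    using \<xi>(3) ker_adj_iff[OF y] by blast
  then have "cinner (?w (adj_op x \<xi>)) \<xi> = cinner (x (adj_op x \<xi>)) \<xi>"
    by (simp add: blinfun.bilinear_simps cinner_simps)
  also have "\<dots> = complex_of_real ((norm (adj_op x \<xi>))\<^sup>2)"
    unfolding cinner_self[symmetric] by (simp add: cinner_adj_right[OF x])
  finally have "(norm (adj_op x \<xi>))\<^sup>2 = cmod (cinner (?w (adj_op x \<xi>)) \<xi>)"
    by (metis norm_of_real abs_of_nonneg zero_le_power2)
  also have "\<dots> \<le> (norm ?w * norm (adj_op x \<xi>)) * norm \<xi>"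
    by (rule order_trans[OF cmod_cinner_le]) (intro mult_right_mono norm_blinfun, simp)
  finally have "(norm x * norm \<xi>) * (norm x * norm \<xi>) \<le> (norm ?w * norm \<xi>) * (norm x * norm \<xi>)"
    by (simp add: norm_eq power2_eq_square mult_ac)
  then show "norm x \<le> norm ?w"
    using \<xi>(1) by (cases "x = 0") (auto simp: mult_le_cancel_right)
qed

text \<open>
  For the direction from left to right a single perturbation suffices: \<open>z = - t y\<^sup>* x\<close> with
  \<open>t = 1 / |y|\<^sup>2\<close>. Then \<open>w = x + y z\<close> satisfies \<open>|w v|\<^sup>2 \<le> |x v|\<^sup>2 - t |y\<^sup>* x v|\<^sup>2\<close>. At a vector \<open>v\<close> where the
  compact operator \<open>w\<close> attains its norm, \<open>|w| \<ge> |x|\<close> leaves no room for the loss: \<open>x\<close> attains its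
  norm at \<open>v\<close> as well and \<open>y\<^sup>* x v = 0\<close>, so \<open>x v\<close> is the common vector.
\<close>

theorem strong_BJ_compact_iff:
  fixes x y :: "'a::chilbert_space \<Rightarrow>\<^sub>L 'a"
  assumes x: "x \<in> compact_ops" and y: "y \<in> compact_ops"
  shows "strong_BJ compact_ops x y \<longleftrightarrow>
    x = 0 \<or> (\<exists>\<xi>. \<xi> \<noteq> 0 \<and> \<xi> \<in> attain_adj x \<and> \<xi> \<in> ker_adj y)"
    (is "?L \<longleftrightarrow> ?R")
proof
  note x' = compact_ops_bounded[OF x] and y' = compact_ops_bounded[OF y]
  {
    assume ?R
    then show ?L
      using strong_BJ_if_attain_ker[OF x' y'] by (auto simp: strong_BJ_def)
  next
    assume BJ: ?L
    show ?R
    proof (cases "x = 0")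
      case False
      define t where "t = 1 / (norm y)\<^sup>2"
      have t: "0 \<le> t" "t * (norm y)\<^sup>2 \<le> 1"
        by (auto simp: t_def)
      define z where "z = ((- t) *\<^sub>R adj_op y) o\<^sub>L x"
      define w where "w = (id_blinfun - t *\<^sub>R (y o\<^sub>L adj_op y)) o\<^sub>L x"
      have z: "z \<in> compact_ops"
        unfolding z_def by (intro compact_ops_compose_left x bounded_ops_scaleR adj_op_bounded y')
      have w: "w \<in> compact_ops"
        unfolding w_def by (intro compact_ops_compose_left x bounded_ops_scaleR bounded_ops_diff
            bounded_ops_id bounded_ops_compose adj_op_bounded y')
      have "w = x + (y o\<^sub>L z)"
        by (rule blinfun_eqI) (simp add: w_def z_def blinfun.bilinear_simps)
      then have norm_w: "norm x \<le> norm w"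
        using BJ z by (simp add: strong_BJ_def)
      then have "w \<noteq> 0" using False by auto
      then obtain v where v: "v \<noteq> 0" "norm (w v) = norm w * norm v"
        using compact_attains_norm[OF w] by (auto simp: norm_attaining_def)
      define a where "a = adj_op y (x v)"
      have "inner (x v) (y a) = (norm a)\<^sup>2"
        by (simp add: a_def power2_norm_eq_inner inner_eq_Re_cinner cinner_adj_left[OF y'])
      moreover have wv: "w v = x v - t *\<^sub>R y a"
        by (simp add: w_def a_def blinfun.bilinear_simps)
      ultimately have "(norm (w v))\<^sup>2 = (norm (x v))\<^sup>2 - 2 * t * (norm a)\<^sup>2 + t\<^sup>2 * (norm (y a))\<^sup>2"
        unfolding wv power2_norm_eq_inner
        by (simp add: inner_simps inner_commute algebra_simps power2_eq_square)
      also have "\<dots> \<le> (norm (x v))\<^sup>2 - 2 * t * (norm a)\<^sup>2 + t * (norm a)\<^sup>2"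
      proof -
        have "t\<^sup>2 * (norm (y a))\<^sup>2 \<le> t\<^sup>2 * ((norm y)\<^sup>2 * (norm a)\<^sup>2)"
          using power_mono[OF norm_blinfun[of y a], of 2]
          by (intro mult_left_mono) (auto simp: power_mult_distrib)
        also have "\<dots> = (t * (norm y)\<^sup>2) * (t * (norm a)\<^sup>2)"
          by (simp add: power2_eq_square)
        also have "\<dots> \<le> 1 * (t * (norm a)\<^sup>2)"
          using t by (intro mult_right_mono) auto
        finally show ?thesis by simp
      qed
      finally have upper: "(norm (w v))\<^sup>2 \<le> (norm (x v))\<^sup>2 - t * (norm a)\<^sup>2"
        by simp
      have "norm (x v) \<le> norm x * norm v"
        by (rule norm_blinfun)
      also have "\<dots> \<le> norm (w v)"
        unfolding v(2) by (intro mult_right_mono norm_w) simp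
      finally have lower: "norm (x v) \<le> norm (w v)" .
      then have "(norm (x v))\<^sup>2 \<le> (norm (w v))\<^sup>2"
        by (intro power_mono) auto
      with upper have "t * (norm a)\<^sup>2 \<le> 0"
        by linarith
      \<comment> \<open>The value \<open>t = 0\<close> arises only as \<open>1 / 0\<close>, that is, for \<open>y = 0\<close>.\<close>
      then have "a = 0 \<or> t = 0"
        using t(1) by (auto simp: mult_le_0_iff)
      moreover have "a = 0" if "y = 0"
      proof -
        have "adj_op y = 0"
          using norm_adj[OF y'] that by simp
        then show ?thesis by (simp add: a_def)
      qed
      ultimately have "a = 0"
        by (auto simp: t_def)
      then have "w v = x v" by (simp add: wv)
      moreover have "norm x * norm v \<le> norm w * norm v"
        by (intro mult_right_mono norm_w) simp
      ultimately have "norm (x v) = norm x * norm v"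
        using v(2) norm_blinfun[of x v] by simp
      then have "x v \<in> attain_adj x"
        by (intro attain_adj_image x') (simp add: norm_attaining_def)
      moreover have "x v \<in> ker_adj y"
        using \<open>a = 0\<close> by (simp add: a_def ker_op_def)
      moreover have "x v \<noteq> 0"
        using \<open>norm (x v) = norm x * norm v\<close> False v(1) by auto
      ultimately show ?thesis by blast
    qed simp
  }
qed

text \<open>
  The vector \<open>\<xi>\<close> is in the range of \<open>x\<close>, being an eigenvector of \<open>x x\<^sup>*\<close> with nonzero eigenvalue, and the
  kernel of the adjoint is the orthogonal complement of the range.
\<close>

lemma attain_adj_orthogonal_ker_adj:
  fixes x :: "'a::chilbert_space \<Rightarrow>\<^sub>L 'a"
  assumes x: "x \<in> bounded_ops" "x \<noteq> 0" and "\<xi> \<in> attain_adj x" "k \<in> ker_adj x"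
  shows "cinner \<xi> k = 0"
proof -
  have "cinner ((norm x)\<^sup>2 *\<^sub>R \<xi>) k = 0"
    using assms by (metis attain_adj_iff ker_adj_iff)
  with x(2) show ?thesis by (simp add: cinner_simps)
qed

lemma ker_adj_scaleC:
  fixes x :: "'a::chilbert_space \<Rightarrow>\<^sub>L 'a"
  assumes "x \<in> bounded_ops" "\<xi> \<in> ker_adj x"
  shows "c *\<^sub>C \<xi> \<in> ker_adj x"
  using assms by (simp add: ker_adj_iff cinner_simps)

text \<open>
  This recovers \<open>M(x)\<close> from strong orthogonality and the kernels \<open>K(y)\<close>. If \<open>\<zeta>\<close> is not in \<open>M(x)\<close>, put
  \<open>f = (|x|\<^sup>2 - x x\<^sup>*) \<zeta>\<close>, which is orthogonal to \<open>M(x)\<close> but not to \<open>\<zeta>\<close>. Composing \<open>x\<close> with the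
  oblique projection along \<open>f\<close> onto the complement of \<open>\<zeta>\<close> gives \<open>y\<close> with \<open>\<zeta> \<in> K(y)\<close>, and on \<open>M(x)\<close>
  the adjoints of \<open>y\<close> and \<open>x\<close> agree; hence \<open>K(y)\<close> meets \<open>M(x)\<close> trivially and \<open>x\<close> is not orthogonal to \<open>y\<close>.
\<close>

lemma attain_adj_iff_strong_BJ:
  fixes x :: "'a::chilbert_space \<Rightarrow>\<^sub>L 'a"
  assumes x: "x \<in> compact_ops" "x \<noteq> 0" and "\<zeta> \<noteq> 0"
  shows "\<zeta> \<in> attain_adj x \<longleftrightarrow>
    (\<forall>y\<in>compact_ops. \<zeta> \<in> ker_adj y \<longrightarrow> strong_BJ compact_ops x y)"
proof
  note x' = compact_ops_bounded[OF x(1)]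
  {
    assume "\<zeta> \<in> attain_adj x"
    then show "\<forall>y\<in>compact_ops. \<zeta> \<in> ker_adj y \<longrightarrow> strong_BJ compact_ops x y"
      using strong_BJ_compact_iff[OF x(1)] \<open>\<zeta> \<noteq> 0\<close> by blast
  next
    assume all: "\<forall>y\<in>compact_ops. \<zeta> \<in> ker_adj y \<longrightarrow> strong_BJ compact_ops x y"
    show "\<zeta> \<in> attain_adj x"
    proof (rule ccontr)
      assume not: "\<zeta> \<notin> attain_adj x"
      define f where "f = (norm x)\<^sup>2 *\<^sub>R \<zeta> - x (adj_op x \<zeta>)"
      define d where "d = (norm x * norm \<zeta>)\<^sup>2 - (norm (adj_op x \<zeta>))\<^sup>2"
      have "norm (adj_op x \<zeta>) \<noteq> norm x * norm \<zeta>"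
        using not by (simp add: norm_attaining_def norm_adj[OF x'])
      then have "d \<noteq> 0"
        unfolding d_def by (simp add: power2_eq_iff_nonneg)
      have f\<zeta>: "cinner f \<zeta> = complex_of_real d"
        unfolding f_def cinner_diff_left cinner_scaleR_left d_def
          cinner_adj_right[OF x', symmetric] cinner_self by (simp add: power_mult_distrib)
      define y where "y = (id_blinfun - (1 / d) *\<^sub>R rank_one f \<zeta>) o\<^sub>L x"
      have y: "y \<in> compact_ops"
        unfolding y_def by (intro compact_ops_compose_left x bounded_ops_diff bounded_ops_id
            bounded_ops_scaleR rank_one_bounded)
      have y_form: "cinner (y u) w = cinner (x u) w - cinner (x u) \<zeta> * cinner f w / complex_of_real d" for u w
        using cinner_commute[of "x u" \<zeta>]
        by (simp add: y_def blinfun.bilinear_simps rank_one.rep_eq cinner_simps)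
      have "\<zeta> \<in> ker_adj y"
        using \<open>d \<noteq> 0\<close> by (simp add: ker_adj_iff compact_ops_bounded[OF y] y_form f\<zeta>)
      with all y have "strong_BJ compact_ops x y" by blast
      then obtain \<xi> where \<xi>: "\<xi> \<noteq> 0" "\<xi> \<in> attain_adj x" "\<xi> \<in> ker_adj y"
        using strong_BJ_compact_iff[OF x(1) y] x(2) by blast
      have "cinner (x (adj_op x \<zeta>)) \<xi> = cinner \<zeta> (x (adj_op x \<xi>))"
        by (simp add: cinner_adj_left[OF x', symmetric] cinner_adj_right[OF x'])
      then have "cinner f \<xi> = 0"
        using \<xi>(2) by (simp add: f_def cinner_simps attain_adj_iff[OF x'])
      then have "cinner (x u) \<xi> = 0" for u
        using \<xi>(3) by (simp add: ker_adj_iff compact_ops_bounded[OF y] y_form)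
      then have "\<xi> \<in> ker_adj x"
        by (simp add: ker_adj_iff[OF x'])
      then show False
        using attain_adj_orthogonal_ker_adj[OF x' x(2) \<xi>(2), of \<xi>] \<xi>(1) by simp
    qed
  }
qed

lemma ker_adj_rank_one:
  fixes u v :: "'a::chilbert_space"
  assumes "v \<noteq> 0"
  shows "ker_adj (rank_one u v) = {w. cinner u w = 0}"
proof -
  have "cinner v v \<noteq> 0" using assms by simp
  then show ?thesis
    by (auto simp: ker_adj_iff[OF rank_one_bounded] rank_one.rep_eq cinner_simps
        simp del: cinner_self_eq_0_iff)
qed

text \<open>
  If \<open>K(x)\<close> is the hyperplane orthogonal to \<open>\<omega>\<close>, then \<open>M(x)\<close>, being nonzero and orthogonal to \<open>K(x)\<close>, is
  the line of \<open>\<omega>\<close>. Such \<open>x\<close> probe membership of a single vector in kernels.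
\<close>

lemma strong_BJ_hyperplane:
  fixes x y :: "'a::chilbert_space \<Rightarrow>\<^sub>L 'a"
  assumes x: "x \<in> compact_ops" and y: "y \<in> compact_ops"
    and \<omega>: "\<omega> \<noteq> 0" "ker_adj x = {w. cinner \<omega> w = 0}"
  shows "strong_BJ compact_ops x y \<longleftrightarrow> \<omega> \<in> ker_adj y"
proof -
  note x' = compact_ops_bounded[OF x]
  have "\<omega> \<notin> ker_adj x" using \<omega> by simp
  then have "x \<noteq> 0"
    by (auto simp: ker_adj_iff[OF x'])
  have multiple: "\<exists>c. \<xi> = c *\<^sub>C \<omega>" if \<xi>: "\<xi> \<in> attain_adj x" for \<xi>
  proof -
    obtain c z where cz: "\<xi> = c *\<^sub>C \<omega> + z" "cinner \<omega> z = 0"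
      using orthogonal_decomposition by blast
    then have "cinner \<xi> z = 0"
      using \<omega>(2) by (intro attain_adj_orthogonal_ker_adj[OF x' \<open>x \<noteq> 0\<close> \<xi>]) simp
    with cz have "z = 0" by (simp add: cinner_simps)
    with cz show ?thesis by auto
  qed
  show ?thesis
  proof
    assume "strong_BJ compact_ops x y"
    then obtain \<xi> where \<xi>: "\<xi> \<noteq> 0" "\<xi> \<in> attain_adj x" "\<xi> \<in> ker_adj y"
      using strong_BJ_compact_iff[OF x y] \<open>x \<noteq> 0\<close> by blast
    obtain c where c: "\<xi> = c *\<^sub>C \<omega>" using multiple[OF \<xi>(2)] by blast
    with \<xi>(1) have "c \<noteq> 0" by auto
    then have "\<omega> = (1 / c) *\<^sub>C \<xi>" by (simp add: c scaleC_scaleC scaleC_one)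
    then show "\<omega> \<in> ker_adj y"
      using ker_adj_scaleC[OF compact_ops_bounded[OF y] \<xi>(3)] by simp
  next
    assume "\<omega> \<in> ker_adj y"
    obtain v where v: "v \<in> norm_attaining x" "v \<noteq> 0"
      using compact_attains_norm[OF x \<open>x \<noteq> 0\<close>] by blast
    then have "x v \<noteq> 0"
      using \<open>x \<noteq> 0\<close> by (auto simp: norm_attaining_def)
    have attain: "x v \<in> attain_adj x"
      by (rule attain_adj_image[OF x' v(1)])
    moreover have "x v \<in> ker_adj y"
      using multiple[OF attain] ker_adj_scaleC[OF compact_ops_bounded[OF y] \<open>\<omega> \<in> ker_adj y\<close>]
      by auto
    ultimately show "strong_BJ compact_ops x y"
      using strong_BJ_compact_iff[OF x y] \<open>x v \<noteq> 0\<close> by blast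
  qed
qed

section \<open>Ray maps preserving orthogonality\<close>

text \<open>
  An additive function fixing 1 fixes the integers; being monotone, it moves \<open>n x\<close> by at most 1 for
  every \<open>n\<close>, hence fixes \<open>x\<close>.
\<close>

lemma additive_nonneg_imp_id:
  fixes h :: "real \<Rightarrow> real"
  assumes add: "\<And>x y. h (x + y) = h x + h y" and nonneg: "\<And>x. 0 \<le> x \<Longrightarrow> 0 \<le> h x"
    and one: "h 1 = 1"
  shows "h x = x"
proof -
  have zero: "h 0 = 0" using add[of 0 0] by simp
  have minus: "h (- y) = - h y" for y using add[of y "- y"] zero by simp
  have diff: "h (y - z) = h y - h z" for y z using add[of y "- z"] minus by simp
  have mono: "h y \<le> h z" if "y \<le> z" for y z
    using nonneg[of "z - y"] that by (simp add: diff)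
  have mult_nat: "h (real n * y) = real n * h y" for n y
    by (induction n) (simp_all add: zero add distrib_right)
  have of_int: "h (of_int k) = of_int k" for k
    using mult_nat[of _ 1] by (cases k rule: int_cases2) (simp_all add: one minus)
  have "real n * \<bar>h x - x\<bar> \<le> 1" for n
  proof -
    have "h (of_int \<lfloor>real n * x\<rfloor>) \<le> h (real n * x)" "h (real n * x) \<le> h (of_int (\<lfloor>real n * x\<rfloor> + 1))"
      by (intro mono; linarith)+
    then have "\<bar>real n * h x - real n * x\<bar> \<le> 1"
      unfolding of_int mult_nat by linarith
    then show ?thesis
      by (simp add: abs_mult flip: right_diff_distrib)
  qed
  moreover have "\<exists>n. 1 < real n * \<bar>h x - x\<bar>" if "h x \<noteq> x"
    using that reals_Archimedean3[of "\<bar>h x - x\<bar>"] by simp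
  ultimately show ?thesis by (meson not_le)
qed

text \<open>
  Commuting with \<open>cnj\<close> means that real numbers have real images. A nonnegative real is a square of
  a real, hence so is its image, and \<open>additive_nonneg_imp_id\<close> applies on the real line. The image of
  \<open>\<i>\<close> is one of the two square roots of \<open>-1\<close>.
\<close>

lemma cnj_equivariant_ring_hom_complex:
  fixes \<sigma> :: "complex \<Rightarrow> complex"
  assumes add: "\<And>a b. \<sigma> (a + b) = \<sigma> a + \<sigma> b" and mult: "\<And>a b. \<sigma> (a * b) = \<sigma> a * \<sigma> b"
    and one: "\<sigma> 1 = 1" and cnj: "\<And>a. \<sigma> (cnj a) = cnj (\<sigma> a)"
  shows "\<sigma> = id \<or> \<sigma> = cnj"
proof -
  have zero: "\<sigma> 0 = 0" using add[of 0 0] by simp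
  have real: "\<sigma> (of_real r) = of_real (Re (\<sigma> (of_real r)))" for r
    using cnj[of "of_real r"] by (auto simp: complex_eq_iff)
  have "Re (\<sigma> (of_real r)) = r" for r
  proof (rule additive_nonneg_imp_id)
    fix x :: real assume "0 \<le> x"
    then have "complex_of_real x = of_real (sqrt x) * of_real (sqrt x)"
      by (simp flip: of_real_mult)
    then have "\<sigma> (of_real x) = of_real (Re (\<sigma> (of_real (sqrt x)))) * of_real (Re (\<sigma> (of_real (sqrt x))))"
      using mult real by metis
    then show "0 \<le> Re (\<sigma> (of_real x))"
      by simp
  qed (simp_all add: add one)
  then have \<sigma>_real: "\<sigma> (of_real r) = of_real r" for r
    using real by metis
  have "\<sigma> \<i> * \<sigma> \<i> = -1"
    using mult[of \<i> \<i>] \<sigma>_real[of "-1"] by simp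
  then have "(\<sigma> \<i> - \<i>) * (\<sigma> \<i> + \<i>) = 0"
    by (simp add: algebra_simps)
  then have "\<sigma> \<i> = \<i> \<or> \<sigma> \<i> = - \<i>"
    by (auto simp: eq_neg_iff_add_eq_0)
  moreover have parts: "\<sigma> c = of_real (Re c) + \<sigma> \<i> * of_real (Im c)" for c
    using add[of "of_real (Re c)" "\<i> * of_real (Im c)"] mult \<sigma>_real complex_eq[of c] by simp
  ultimately show ?thesis
  proof (elim disjE)
    assume "\<sigma> \<i> = \<i>"
    then have "\<sigma> c = id c" for c
      using parts[of c] by (simp add: complex_eq_iff)
    then show ?thesis by blast
  next
    assume "\<sigma> \<i> = - \<i>"
    then have "\<sigma> c = cnj c" for c
      using parts[of c] by (simp add: complex_eq_iff)
    then show ?thesis by blast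
  qed
qed

text \<open>
  A map of rays is given by representatives: \<open>\<phi> x\<close> matters only up to a nonzero scalar. The assumption
  \<open>room\<close> is how dimension at least 3 enters.
\<close>

locale orthogonality_ray_map =
  fixes \<phi> :: "'a::complex_inner \<Rightarrow> 'a"
  assumes orth: "cinner (\<phi> x) (\<phi> y) = 0 \<longleftrightarrow> cinner x y = 0"
    and surj: "\<exists>x c. w = c *\<^sub>C \<phi> x"
    and room: "\<exists>z::'a. z \<noteq> 0 \<and> cinner a z = 0 \<and> cinner b z = 0"
begin

lemma zero_iff [simp]: "\<phi> x = 0 \<longleftrightarrow> x = 0"
  using orth[of x x] by simp

lemma map_zero [simp]: "\<phi> 0 = 0"
  by simp

text \<open>
  The span of two vectors is the double orthogonal complement of the pair, so the ray map is a
  collineation.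
\<close>

lemma span2: "\<exists>a' b'. \<phi> (a *\<^sub>C x + b *\<^sub>C y) = a' *\<^sub>C \<phi> x + b' *\<^sub>C \<phi> y"
proof -
  let ?z = "a *\<^sub>C x + b *\<^sub>C y"
  obtain a' b' w where w: "\<phi> ?z = a' *\<^sub>C \<phi> x + b' *\<^sub>C \<phi> y + w"
    "cinner (\<phi> x) w = 0" "cinner (\<phi> y) w = 0"
    by (rule orthogonal_decomposition2)
  obtain u c where u: "w = c *\<^sub>C \<phi> u" using surj by blast
  have "w = 0"
  proof (cases "c = 0")
    case False
    then have "cinner x u = 0" "cinner y u = 0"
      using w(2,3) by (auto simp: u cinner_simps orth)
    then have "cinner (\<phi> ?z) (\<phi> u) = 0"
      by (simp add: orth cinner_simps)
    then have "cinner (\<phi> ?z) w = 0"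
      by (simp add: u cinner_simps)
    with w show "w = 0"
      by (simp add: cinner_simps)
  qed (simp add: u)
  with w(1) show ?thesis by auto
qed

lemma multiple: "\<exists>b. \<phi> (a *\<^sub>C x) = b *\<^sub>C \<phi> x"
  using span2[of a x 0 0] by simp

end

text \<open>
  The rays not orthogonal to \<open>e\<close> are represented uniquely by vectors \<open>e + x\<close> with \<open>x\<close> orthogonal to \<open>e\<close>.
  The function \<open>chart\<close> below is the ray map between this affine chart and the one at \<open>e'\<close>.
\<close>

locale ray_map_chart = orthogonality_ray_map +
  fixes e e' :: "'a::complex_inner"
  assumes e: "norm e = 1" and e': "e' = (1 / norm (\<phi> e)) *\<^sub>R \<phi> e"
begin

lemma e_nonzero: "e \<noteq> 0"
  using e by auto

lemma cinner_e [simp]: "cinner e e = 1" "cinner e' e' = 1"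
  using e_nonzero by (simp_all add: cinner_self e e')

lemma orth_e': "cinner e' (\<phi> x) = 0 \<longleftrightarrow> cinner e x = 0"
  using e_nonzero by (simp add: e' cinner_simps orth)

definition normalize :: "'a \<Rightarrow> 'a" where
  "normalize v = (1 / cinner e' (\<phi> v)) *\<^sub>C \<phi> v"

definition chart :: "'a \<Rightarrow> 'a" where
  "chart x = normalize (e + x) - e'"

lemma cinner_chart_e':
  assumes "cinner e x = 0"
  shows "cinner e' (chart x) = 0"
  using orth_e'[of "e + x"] assms by (simp add: chart_def normalize_def cinner_simps)

text \<open>
  The ray of \<open>e + x\<close> is mapped into the span of the images of \<open>e\<close> and \<open>x\<close>, and the component along \<open>e'\<close>
  is normalised to 1, so what remains is a multiple of \<open>\<phi> x\<close>.
\<close>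

lemma chart_multiple:
  assumes x: "cinner e x = 0"
  shows "\<exists>c. c \<noteq> 0 \<and> chart x = c *\<^sub>C \<phi> x"
proof -
  obtain a b where ab: "\<phi> (e + x) = a *\<^sub>C \<phi> e + b *\<^sub>C \<phi> x"
    using span2[of 1 e 1 x] by (auto simp: scaleC_one)
  define k where "k = cinner e' (\<phi> (e + x))"
  have "k \<noteq> 0"
    using orth_e'[of "e + x"] x by (simp add: k_def cinner_simps)
  have e'_multiple: "\<phi> e = norm (\<phi> e) *\<^sub>C e'"
    using e_nonzero by (simp add: e' flip: scaleR_eq_scaleC)
  have "chart x = (1 / k) *\<^sub>C (a *\<^sub>C \<phi> e + b *\<^sub>C \<phi> x) - e'"
    by (simp add: chart_def normalize_def k_def flip: ab)
  also have "\<dots> = (a * norm (\<phi> e) / k - 1) *\<^sub>C e' + (b / k) *\<^sub>C \<phi> x"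
    by (subst e'_multiple)
      (simp add: scaleC_add_right scaleC_scaleC complex_vector.scale_left_diff_distrib scaleC_one)
  finally have gx: "chart x = (a * norm (\<phi> e) / k - 1) *\<^sub>C e' + (b / k) *\<^sub>C \<phi> x" .
  have "cinner e' (\<phi> x) = 0" using orth_e' x by simp
  then have "a * norm (\<phi> e) / k - 1 = 0"
    using cinner_chart_e'[OF x] by (simp add: gx cinner_simps)
  then have gx': "chart x = (b / k) *\<^sub>C \<phi> x"
    by (simp add: gx)
  show ?thesis
  proof (cases "x = 0")
    case True
    then show ?thesis using gx' by (intro exI[of _ 1]) simp
  next
    case False
    have "b \<noteq> 0"
    proof
      assume "b = 0"
      then have "cinner (\<phi> x) (\<phi> (e + x)) = 0"
        using orth[of x e] x by (simp add: ab cinner_simps) (simp add: cinner_eq_0_commute)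
      then have "cinner x e + cinner x x = 0"
        by (simp add: orth cinner_simps)
      with x False show False
        using cinner_eq_0_commute[of e x] by simp
    qed
    with \<open>k \<noteq> 0\<close> gx' show ?thesis
      by (intro exI[of _ "b / k"]) simp
  qed
qed

lemma chart_zero [simp]: "chart 0 = 0"
  using chart_multiple[of 0] by auto

lemma chart_orth:
  assumes "cinner e x = 0" "cinner e y = 0"
  shows "cinner (chart x) (chart y) = 0 \<longleftrightarrow> cinner x y = 0"
proof -
  obtain c d where "c \<noteq> 0" "chart x = c *\<^sub>C \<phi> x" "d \<noteq> 0" "chart y = d *\<^sub>C \<phi> y"
    using chart_multiple assms by metis
  then show ?thesis by (simp add: cinner_simps orth)
qed

text \<open>
  The vectors \<open>e + x\<close> and \<open>e + y\<close> are orthogonal iff \<open>\<langle>x, y\<rangle> = -1\<close>. Thus preservation of orthogonality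
  in the chart carries information about a nonzero value of the inner product.
\<close>

lemma chart_minus_one:
  assumes x: "cinner e x = 0" and y: "cinner e y = 0"
  shows "cinner (chart x) (chart y) = -1 \<longleftrightarrow> cinner x y = -1"
proof -
  have xe: "cinner x e = 0" and ge: "cinner (chart x) e' = 0"
    using x cinner_chart_e'[OF x] by (simp_all add: cinner_eq_0_commute)
  have "normalize (e + x) = e' + chart x" "normalize (e + y) = e' + chart y"
    by (simp_all add: chart_def)
  then have "cinner (normalize (e + x)) (normalize (e + y)) = 1 + cinner (chart x) (chart y)"
    by (simp add: cinner_simps cinner_chart_e'[OF y] ge)
  moreover have "cinner (e + x) (e + y) = 1 + cinner x y"
    by (simp add: cinner_simps y xe)
  moreover have "cinner e' (\<phi> (e + x)) \<noteq> 0" "cinner e' (\<phi> (e + y)) \<noteq> 0"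
    using x y by (simp_all add: orth_e' cinner_simps)
  then have "cinner (normalize (e + x)) (normalize (e + y)) = 0 \<longleftrightarrow> cinner (e + x) (e + y) = 0"
    by (simp add: normalize_def cinner_scaleC_left cinner_scaleC_right orth)
  ultimately have "1 + cinner (chart x) (chart y) = 0 \<longleftrightarrow> 1 + cinner x y = 0"
    by simp
  then show ?thesis
    by (simp add: add_eq_0_iff)
qed

lemma chart_scale:
  assumes x: "cinner e x = 0"
  shows "\<exists>k. chart (c *\<^sub>C x) = k *\<^sub>C chart x"
proof -
  obtain b where b: "\<phi> (c *\<^sub>C x) = b *\<^sub>C \<phi> x" using multiple by blast
  obtain m where m: "m \<noteq> 0" "chart x = m *\<^sub>C \<phi> x" using chart_multiple[OF x] by blast
  obtain n where n: "chart (c *\<^sub>C x) = n *\<^sub>C \<phi> (c *\<^sub>C x)"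
    using chart_multiple[of "c *\<^sub>C x"] x by (auto simp: cinner_simps)
  have "chart (c *\<^sub>C x) = (n * b / m) *\<^sub>C chart x"
    using m by (simp add: n b scaleC_scaleC)
  then show ?thesis ..
qed

text \<open>
  For fixed \<open>u\<close> the value \<open>\<langle>chart u, chart v\<rangle>\<close> depends only on \<open>\<langle>u, v\<rangle>\<close>: a nonzero value of the latter
  becomes \<open>-1\<close> after rescaling \<open>u\<close>, which rescales \<open>chart u\<close> by a factor that does not involve \<open>v\<close>.
\<close>

lemma chart_form_cong_right:
  assumes u: "cinner e u = 0" and v: "cinner e v = 0" and w: "cinner e w = 0"
    and eq: "cinner u v = cinner u w"
  shows "cinner (chart u) (chart v) = cinner (chart u) (chart w)"
proof (cases "cinner u v = 0")
  case True
  then show ?thesis using chart_orth[OF u v] chart_orth[OF u w] eq by simp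
next
  case False
  define c where "c = - 1 / cnj (cinner u v)"
  obtain k where k: "chart (c *\<^sub>C u) = k *\<^sub>C chart u" using chart_scale[OF u] by blast
  have cu: "cinner e (c *\<^sub>C u) = 0" using u by (simp add: cinner_simps)
  have "cinner (c *\<^sub>C u) v = -1" "cinner (c *\<^sub>C u) w = -1"
    using False eq by (simp_all add: c_def cinner_simps)
  then have "cnj k * cinner (chart u) (chart v) = -1" "cnj k * cinner (chart u) (chart w) = -1"
    using chart_minus_one[OF cu v] chart_minus_one[OF cu w] by (simp_all add: k cinner_simps)
  then have "cnj k * cinner (chart u) (chart v) = cnj k * cinner (chart u) (chart w)" "k \<noteq> 0"
    by auto
  then show ?thesis by simp
qed

lemma chart_form_cong_left:
  assumes u: "cinner e u = 0" and v: "cinner e v = 0" and w: "cinner e w = 0"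
    and eq: "cinner v u = cinner w u"
  shows "cinner (chart v) (chart u) = cinner (chart w) (chart u)"
proof -
  have "cinner u v = cinner u w"
    using eq by (metis cinner_commute)
  then have "cinner (chart u) (chart v) = cinner (chart u) (chart w)"
    by (rule chart_form_cong_right[OF u v w])
  then show ?thesis by (metis cinner_commute)
qed

text \<open>
  The image of \<open>x + y\<close> is a combination of the orthogonal vectors \<open>chart x\<close> and \<open>chart y\<close>. As
  \<open>\<langle>x, x + y\<rangle> = \<langle>x, x\<rangle>\<close>, the first coefficient is 1, and likewise the second.
\<close>

lemma chart_add_orthogonal:
  assumes x: "cinner e x = 0" and y: "cinner e y = 0" and xy: "cinner x y = 0"
  shows "chart (x + y) = chart x + chart y"
proof -
  have ex: "cinner e (x + y) = 0" using x y by (simp add: cinner_simps)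
  have yx: "cinner y x = 0" using xy by (simp add: cinner_eq_0_commute)
  obtain m n k where mnk: "m \<noteq> 0" "chart x = m *\<^sub>C \<phi> x" "n \<noteq> 0" "chart y = n *\<^sub>C \<phi> y"
    "chart (x + y) = k *\<^sub>C \<phi> (x + y)"
    using chart_multiple x y ex by metis
  obtain a b where ab: "\<phi> (x + y) = a *\<^sub>C \<phi> x + b *\<^sub>C \<phi> y"
    using span2[of 1 x 1 y] by (auto simp: scaleC_one)
  define a' b' where "a' = k * a / m" and "b' = k * b / n"
  have eq: "chart (x + y) = a' *\<^sub>C chart x + b' *\<^sub>C chart y"
    using mnk by (simp add: ab scaleC_add_right scaleC_scaleC a'_def b'_def)
  have "cinner (chart x) (chart y) = 0" "cinner (chart y) (chart x) = 0"
    using chart_orth[OF x y] chart_orth[OF y x] xy yx by auto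
  moreover have "cinner (chart x) (chart (x + y)) = cinner (chart x) (chart x)"
    by (rule chart_form_cong_right[OF x ex x]) (simp add: cinner_simps xy)
  moreover have "cinner (chart y) (chart (x + y)) = cinner (chart y) (chart y)"
    by (rule chart_form_cong_right[OF y ex y]) (simp add: cinner_simps yx)
  ultimately have "chart x = 0 \<or> a' = 1" "chart y = 0 \<or> b' = 1"
    by (simp_all add: eq cinner_simps)
  then show ?thesis
    by (auto simp: eq scaleC_one)
qed

text \<open>
  Only the inner products with \<open>u\<close> matter, so \<open>v\<close> and \<open>w\<close> may be replaced by suitable multiples of
  \<open>u + z\<close> and \<open>u - z\<close>, where \<open>z\<close> is orthogonal to \<open>u\<close> and of the same length. These are orthogonal to each
  other, where additivity is known.
\<close>

lemma chart_form_add: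
  assumes u: "cinner e u = 0" and v: "cinner e v = 0" and w: "cinner e w = 0"
  shows "cinner (chart u) (chart (v + w)) = cinner (chart u) (chart v) + cinner (chart u) (chart w)"
proof (cases "u = 0")
  case False
  obtain z0 where z0: "z0 \<noteq> 0" "cinner e z0 = 0" "cinner u z0 = 0"
    using room by blast
  define z where "z = (norm u / norm z0) *\<^sub>R z0"
  have uz: "cinner u z = 0" "cinner z u = 0" and zz: "cinner z z = cinner u u"
    and z: "cinner e z = 0"
    using z0 cinner_eq_0_commute[of u z0] by (simp_all add: z_def cinner_simps cinner_self power2_eq_square)
  define q where "q = cinner u u"
  have "q \<noteq> 0" using False by (simp add: q_def)
  define \<alpha> \<beta> where "\<alpha> = cinner u v / q" and "\<beta> = cinner u w / q"
  let ?x = "\<alpha> *\<^sub>C (u + z)" and ?y = "\<beta> *\<^sub>C (u - z)"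
  have x: "cinner e ?x = 0" and y: "cinner e ?y = 0" and xy: "cinner ?x ?y = 0"
    using u z uz zz by (simp_all add: cinner_simps)
  have xy': "cinner e (?x + ?y) = 0" and vw: "cinner e (v + w) = 0"
    using x y v w by (simp_all add: cinner_add_right)
  have ux: "cinner u ?x = cinner u v" and uy: "cinner u ?y = cinner u w"
    using \<open>q \<noteq> 0\<close> uz by (simp_all add: cinner_simps \<alpha>_def \<beta>_def flip: q_def)
  have "cinner (chart u) (chart (v + w)) = cinner (chart u) (chart (?x + ?y))"
    by (rule chart_form_cong_right[OF u vw xy']) (simp only: cinner_add_right ux uy)
  also have "\<dots> = cinner (chart u) (chart ?x) + cinner (chart u) (chart ?y)"
    by (simp only: chart_add_orthogonal[OF x y xy] cinner_add_right)
  also have "cinner (chart u) (chart ?x) = cinner (chart u) (chart v)"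
    by (rule chart_form_cong_right[OF u x v ux])
  also have "cinner (chart u) (chart ?y) = cinner (chart u) (chart w)"
    by (rule chart_form_cong_right[OF u y w uy])
  finally show ?thesis .
qed simp

text \<open>
  The multiples of values of \<open>chart\<close> exhaust the complement of \<open>e'\<close>, so they are enough to test
  identities between vectors of that complement.
\<close>

lemma chart_surj:
  assumes "cinner e' w = 0"
  shows "\<exists>u c. cinner e u = 0 \<and> w = c *\<^sub>C chart u"
proof (cases "w = 0")
  case True
  then show ?thesis by (intro exI[of _ 0]) simp
next
  case False
  obtain u c where u: "w = c *\<^sub>C \<phi> u" using surj by blast
  with False have "c \<noteq> 0" by auto
  with assms have eu: "cinner e u = 0"
    by (simp add: u cinner_simps orth_e')
  then obtain k where "k \<noteq> 0" "chart u = k *\<^sub>C \<phi> u" using chart_multiple by blast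
  then have "w = (c / k) *\<^sub>C chart u"
    by (simp add: u scaleC_scaleC)
  with eu show ?thesis by blast
qed

lemma chart_add:
  assumes x: "cinner e x = 0" and y: "cinner e y = 0"
  shows "chart (x + y) = chart x + chart y"
proof -
  define D where "D = chart (x + y) - (chart x + chart y)"
  have "cinner e' D = 0"
    using x y by (simp add: D_def cinner_simps cinner_chart_e')
  then obtain u c where u: "cinner e u = 0" "D = c *\<^sub>C chart u"
    using chart_surj by blast
  have "cinner (chart u) D = 0"
    using chart_form_add[OF u(1) x y] by (simp add: D_def cinner_simps)
  then have "cinner D D = 0"
    by (metis u(2) cinner_scaleC_left mult_zero_right)
  then show ?thesis by (simp add: D_def)
qed

definition u0 :: 'a where
  "u0 = (SOME u. norm u = 1 \<and> cinner e u = 0)"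

lemma u0: "norm u0 = 1" "cinner e u0 = 0"
proof -
  obtain z where "z \<noteq> 0" "cinner e z = 0" using room by blast
  then have "\<exists>u. norm u = 1 \<and> cinner e u = 0"
    by (intro exI[of _ "(1 / norm z) *\<^sub>R z"]) (simp add: cinner_simps)
  then show "norm u0 = 1" "cinner e u0 = 0"
    unfolding u0_def by (metis (mono_tags, lifting) someI_ex)+
qed

lemma cinner_u0 [simp]: "cinner u0 u0 = 1"
  by (simp add: cinner_self u0)

text \<open>
  The choice of \<open>u0\<close> is immaterial: by \<open>chart_form\<close> the same \<open>\<sigma>\<close> describes the form on all pairs of
  vectors.
\<close>

definition \<sigma> :: "complex \<Rightarrow> complex" where
  "\<sigma> c = cinner (chart u0) (chart (c *\<^sub>C u0))"

text \<open>
  Each of the two arguments may be varied as long as the inner product \<open>c\<close> is kept. If \<open>x\<close> is not a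
  multiple of \<open>u0\<close>, some \<open>v\<close> has product \<open>c\<close> with both \<open>x\<close> and \<open>u0\<close>, giving a path from \<open>(x, y)\<close> over
  \<open>(x, v)\<close> and \<open>(u0, v)\<close> to \<open>(u0, c u0)\<close>. A multiple of \<open>u0\<close> is first moved off that line by adding a
  vector orthogonal to it.
\<close>

lemma chart_form:
  assumes x: "cinner e x = 0" and y: "cinner e y = 0"
  shows "cinner (chart x) (chart y) = \<sigma> (cinner x y)"
proof -
  have generic: "cinner (chart x) (chart y) = \<sigma> (cinner x y)"
    if x: "cinner e x = 0" and y: "cinner e y = 0" and indep: "\<nexists>a. x = a *\<^sub>C u0" for x y
  proof -
    define c where "c = cinner x y"
    obtain a z where az: "x = a *\<^sub>C u0 + z" "cinner u0 z = 0"
      by (rule orthogonal_decomposition)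
    with indep have "z \<noteq> 0" by auto
    have ez: "cinner e z = 0"
      using x u0 by (simp add: az(1) cinner_simps)
    have zu: "cinner z u0 = 0" using az(2) by (simp add: cinner_eq_0_commute)
    define v where "v = c *\<^sub>C u0 + ((c - cnj a * c) / cinner z z) *\<^sub>C z"
    have v: "cinner e v = 0" using u0 ez by (simp add: v_def cinner_simps)
    have xv: "cinner x v = c"
      using \<open>z \<noteq> 0\<close> by (simp add: v_def az cinner_simps zu)
    have uv: "cinner u0 v = c"
      by (simp add: v_def az cinner_simps)
    have cu: "cinner e (c *\<^sub>C u0) = 0" using u0 by (simp add: cinner_simps)
    have "cinner (chart x) (chart y) = cinner (chart x) (chart v)"
      by (rule chart_form_cong_right[OF x y v]) (simp add: xv c_def)
    also have "\<dots> = cinner (chart u0) (chart v)"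
      by (rule chart_form_cong_left[OF v x u0(2)]) (simp add: xv uv)
    also have "\<dots> = \<sigma> c"
      unfolding \<sigma>_def by (rule chart_form_cong_right[OF u0(2) v cu]) (simp add: uv cinner_simps)
    finally show ?thesis by (simp add: c_def)
  qed
  show ?thesis
  proof (cases "\<exists>a. x = a *\<^sub>C u0")
    case True
    then obtain a where a: "x = a *\<^sub>C u0" by blast
    show ?thesis
    proof (cases "cinner x y = 0")
      case True
      then show ?thesis
        using chart_orth[OF x y] by (simp add: \<sigma>_def)
    next
      case False
      then have "a \<noteq> 0" by (auto simp: a)
      obtain z where z: "z \<noteq> 0" "cinner e z = 0" "cinner u0 z = 0"
        using room by blast
      have zu: "cinner z u0 = 0" using z(3) by (simp add: cinner_eq_0_commute)
      define y' where "y' = (cinner x y / cnj a) *\<^sub>C u0"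
      have xz: "cinner e (x + z) = 0" and y': "cinner e y' = 0"
        using x z u0 by (simp_all add: y'_def cinner_simps)
      have xy': "cinner x y' = cinner x y" and xzy': "cinner (x + z) y' = cinner x y"
        using \<open>a \<noteq> 0\<close> zu by (simp_all add: y'_def cinner_simps a)
      have "\<nexists>b. x + z = b *\<^sub>C u0"
      proof
        assume "\<exists>b. x + z = b *\<^sub>C u0"
        then obtain b where "x + z = b *\<^sub>C u0" by blast
        then have "z = (b - a) *\<^sub>C u0"
          by (simp add: a complex_vector.scale_left_diff_distrib algebra_simps)
        with z show False by (auto simp: cinner_simps)
      qed
      then have "cinner (chart (x + z)) (chart y') = \<sigma> (cinner x y)"
        using generic[OF xz y'] by (simp only: xzy' not_False_eq_True)
      moreover have "cinner (chart (x + z)) (chart y') = cinner (chart x) (chart y')"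
        by (rule chart_form_cong_left[OF y' xz x]) (simp only: xzy' xy')
      moreover have "cinner (chart x) (chart y') = cinner (chart x) (chart y)"
        by (rule chart_form_cong_right[OF x y' y xy'])
      ultimately show ?thesis by simp
    qed
  qed (use generic x y in blast)
qed

lemma e_scale_u0: "cinner e (c *\<^sub>C u0) = 0"
  using u0 by (simp add: cinner_simps)

lemma \<sigma>_add: "\<sigma> (a + b) = \<sigma> a + \<sigma> b"
  unfolding \<sigma>_def scaleC_add_left
  by (rule chart_form_add) (simp_all add: u0 e_scale_u0)

lemma \<sigma>_zero: "\<sigma> 0 = 0"
  by (simp add: \<sigma>_def)

lemma \<sigma>_one: "\<sigma> 1 = 1"
proof -
  have "\<sigma> (-1) = -1"
    unfolding \<sigma>_def by (subst chart_minus_one) (simp_all add: u0 e_scale_u0 cinner_simps)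
  then show ?thesis
    using \<sigma>_add[of 1 "-1"] \<sigma>_zero by (simp add: add_eq_0_iff)
qed

lemma \<sigma>_cnj: "\<sigma> (cnj a) = cnj (\<sigma> a)"
proof -
  have "\<sigma> (cnj a) = cinner (chart (a *\<^sub>C u0)) (chart u0)"
    by (subst chart_form) (simp_all add: u0 e_scale_u0 cinner_simps)
  also have "\<dots> = cnj (cinner (chart u0) (chart (a *\<^sub>C u0)))"
    by (rule cinner_commute)
  also have "\<dots> = cnj (\<sigma> a)" by (simp only: \<sigma>_def)
  finally show ?thesis .
qed

text \<open>
  The factor, which exists by \<open>chart_scale\<close>, is read off by pairing with the multiple of \<open>x\<close> whose product
  with \<open>x\<close> is 1.
\<close>

lemma chart_scaleC:
  assumes x: "cinner e x = 0"
  shows "chart (c *\<^sub>C x) = \<sigma> c *\<^sub>C chart x"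
proof (cases "x = 0")
  case False
  define y where "y = (1 / cinner x x) *\<^sub>C x"
  have yx: "cinner y x = 1"
    using False cinner_self[of x] by (simp add: y_def cinner_simps)
  have y: "cinner e y = 0" and cx: "cinner e (c *\<^sub>C x) = 0"
    using x by (simp_all add: y_def cinner_simps)
  obtain k where k: "chart (c *\<^sub>C x) = k *\<^sub>C chart x" using chart_scale[OF x] by blast
  have "\<sigma> c = cinner (chart y) (chart (c *\<^sub>C x))"
    by (subst chart_form[OF y cx]) (simp add: cinner_simps yx)
  also have "\<dots> = k * \<sigma> 1"
    by (simp add: k cinner_simps chart_form[OF y x] yx)
  finally show ?thesis by (simp add: k \<sigma>_one)
qed simp

lemma \<sigma>_mult: "\<sigma> (a * b) = \<sigma> a * \<sigma> b"
proof -
  have "chart ((a * b) *\<^sub>C u0) = \<sigma> a *\<^sub>C \<sigma> b *\<^sub>C chart u0"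
    by (simp add: chart_scaleC e_scale_u0 u0 flip: scaleC_scaleC)
  then have "\<sigma> (a * b) = \<sigma> a * \<sigma> b * cinner (chart u0) (chart u0)"
    unfolding \<sigma>_def[of "a * b"] by (simp add: cinner_simps)
  then show ?thesis
    using chart_form[of u0 u0] by (simp add: u0 \<sigma>_one)
qed

lemma \<sigma>_cases: "\<sigma> = id \<or> \<sigma> = cnj"
  by (intro cnj_equivariant_ring_hom_complex \<sigma>_add \<sigma>_mult \<sigma>_one \<sigma>_cnj)

text \<open>
  The semilinear extension of the chart, \<open>t e + x \<mapsto> \<sigma> t e' + chart x\<close>.
\<close>

definition U :: "'a \<Rightarrow> 'a" where
  "U v = \<sigma> (cinner e v) *\<^sub>C e' + chart (v - cinner e v *\<^sub>C e)"

lemma e_component: "cinner e (v - cinner e v *\<^sub>C e) = 0"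
  by (simp add: cinner_simps)

lemma U_add: "U (v + w) = U v + U w"
proof -
  have split: "v + w - cinner e (v + w) *\<^sub>C e = (v - cinner e v *\<^sub>C e) + (w - cinner e w *\<^sub>C e)"
    by (simp add: cinner_simps scaleC_add_left)
  show ?thesis
    unfolding U_def split chart_add[OF e_component[of v] e_component[of w]]
    by (simp add: cinner_add_right \<sigma>_add scaleC_add_left)
qed

lemma U_scaleC: "U (a *\<^sub>C v) = \<sigma> a *\<^sub>C U v"
proof -
  have "a *\<^sub>C v - cinner e (a *\<^sub>C v) *\<^sub>C e = a *\<^sub>C (v - cinner e v *\<^sub>C e)"
    by (simp add: cinner_simps scaleC_scaleC complex_vector.scale_right_diff_distrib)
  then show ?thesis
    using chart_scaleC[OF e_component[of v], of a]
    by (simp add: U_def cinner_scaleC_right \<sigma>_mult scaleC_add_right scaleC_scaleC)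
qed

lemma cinner_U: "cinner (U v) (U w) = \<sigma> (cinner v w)"
proof -
  define x y where "x = v - cinner e v *\<^sub>C e" and "y = w - cinner e w *\<^sub>C e"
  have x: "cinner e x = 0" and y: "cinner e y = 0"
    unfolding x_def y_def by (rule e_component)+
  have xe: "cinner x e = 0" and ge: "cinner (chart x) e' = 0"
    using x cinner_chart_e'[OF x] by (simp_all add: cinner_eq_0_commute)
  have "cinner (U v) (U w) = cnj (\<sigma> (cinner e v)) * \<sigma> (cinner e w) + cinner (chart x) (chart y)"
    unfolding U_def x_def[symmetric] y_def[symmetric]
    by (simp add: cinner_simps cinner_chart_e'[OF y] ge)
  also have "\<dots> = \<sigma> (cnj (cinner e v) * cinner e w + cinner x y)"
    by (simp add: \<sigma>_add \<sigma>_mult \<sigma>_cnj chart_form[OF x y])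
  also have "cnj (cinner e v) * cinner e w + cinner x y
      = cinner (cinner e v *\<^sub>C e + x) (cinner e w *\<^sub>C e + y)"
    by (simp add: cinner_simps y xe)
  also have "\<dots> = cinner v w"
    by (simp add: x_def y_def)
  finally show ?thesis .
qed

lemma norm_U: "norm (U v) = norm v"
proof -
  have "complex_of_real ((norm (U v))\<^sup>2) = complex_of_real ((norm v)\<^sup>2)"
    using cinner_U[of v v] \<sigma>_cases unfolding cinner_self by auto
  then show ?thesis
    by (simp only: of_real_eq_iff power2_eq_iff_nonneg norm_ge_zero)
qed

lemma U_multiple: "\<exists>k. k \<noteq> 0 \<and> U v = k *\<^sub>C \<phi> v"
proof -
  have *: "\<exists>k. U v = k *\<^sub>C \<phi> v"
  proof (cases "cinner e v = 0")
    case True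
    then show ?thesis
      using chart_multiple[OF True] by (auto simp: U_def \<sigma>_zero)
  next
    case False
    define c where "c = cinner e v"
    define x where "x = (1 / c) *\<^sub>C (v - c *\<^sub>C e)"
    have "c \<noteq> 0" using False by (simp add: c_def)
    have x: "cinner e x = 0"
      by (simp add: x_def c_def cinner_simps)
    have ex: "e + x = (1 / c) *\<^sub>C v"
      using \<open>c \<noteq> 0\<close> by (simp add: x_def complex_vector.scale_right_diff_distrib scaleC_scaleC scaleC_one)
    have "v - c *\<^sub>C e = c *\<^sub>C x"
      using \<open>c \<noteq> 0\<close> by (simp add: x_def scaleC_scaleC scaleC_one)
    then have "U v = \<sigma> c *\<^sub>C (e' + chart x)"
      by (simp add: U_def chart_scaleC[OF x] scaleC_add_right flip: c_def)
    also have "e' + chart x = normalize ((1 / c) *\<^sub>C v)"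
      by (simp add: chart_def ex)
    finally have "U v = \<sigma> c *\<^sub>C normalize ((1 / c) *\<^sub>C v)" .
    moreover obtain b where "\<phi> ((1 / c) *\<^sub>C v) = b *\<^sub>C \<phi> v"
      using multiple by blast
    ultimately show ?thesis
      by (auto simp: normalize_def scaleC_scaleC)
  qed
  show ?thesis
  proof (cases "v = 0")
    case True
    then show ?thesis
      using norm_U[of 0] by (intro exI[of _ 1]) simp
  next
    case False
    obtain k where k: "U v = k *\<^sub>C \<phi> v" using * by blast
    then have "k \<noteq> 0" using False norm_U[of v] by auto
    with k show ?thesis by blast
  qed
qed

lemma bij_U: "bij U"
proof (rule bijI)
  show "inj U"
  proof (rule injI)
    fix v w assume "U v = U w"
    then have "U (v - w) = 0"
      using U_add[of "v - w" w] by simp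
    then have "norm (v - w) = 0"
      using norm_U[of "v - w"] by simp
    then show "v = w" by simp
  qed
  have "\<exists>v. w = U v" for w
  proof -
    obtain x c where w: "w = c *\<^sub>C \<phi> x" using surj by blast
    obtain k where k: "k \<noteq> 0" "U x = k *\<^sub>C \<phi> x" using U_multiple by blast
    obtain d where d: "\<sigma> d = c / k"
      using \<sigma>_cases by (metis complex_cnj_cnj id_apply)
    have "w = U (d *\<^sub>C x)"
      using k by (simp add: U_scaleC d w scaleC_scaleC)
    then show ?thesis ..
  qed
  then show "surj U" by (auto simp: surj_def)
qed

lemma unitary_or_antiunitary: "unitary_op U \<or> antiunitary_op U"
  using \<sigma>_cases
proof
  assume "\<sigma> = id"
  then have "unitary_op U"
    using U_add U_scaleC cinner_U bij_U
    by (simp add: unitary_op_def Vector_Spaces.linear_iff complex_vector.vector_space_axioms)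
  then show ?thesis ..
next
  assume "\<sigma> = cnj"
  then have "antiunitary_op U"
    using U_add U_scaleC norm_U bij_U by (simp add: antiunitary_op_def conj_linear_def)
  then show ?thesis ..
qed

end

text \<open>
  Uhlhorn's theorem: a bijection of rays that preserves orthogonality in both directions is induced
  by a unitary or anti-unitary operator.
\<close>

theorem (in orthogonality_ray_map) uhlhorn:
  "\<exists>U. (unitary_op U \<or> antiunitary_op U) \<and> (\<forall>x. \<exists>k. k \<noteq> 0 \<and> U x = k *\<^sub>C \<phi> x)"
proof -
  obtain z :: 'a where "z \<noteq> 0" using room by blast
  then interpret ray_map_chart \<phi> "(1 / norm z) *\<^sub>R z"
    "(1 / norm (\<phi> ((1 / norm z) *\<^sub>R z))) *\<^sub>R \<phi> ((1 / norm z) *\<^sub>R z)"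
    by unfold_locales auto
  show ?thesis
    using unitary_or_antiunitary U_multiple by blast
qed

text \<open>
  Of three independent vectors, one lies outside the span of \<open>a\<close> and \<open>b\<close>; its component orthogonal to
  both is the required vector.
\<close>

lemma room_of_cdim:
  fixes a b :: "'a::complex_inner"
  assumes "cdim_at_least 3 TYPE('a)"
  shows "\<exists>z. z \<noteq> 0 \<and> cinner a z = 0 \<and> cinner b z = 0"
proof -
  obtain B :: "'a set" where B: "finite B" "card B = 3" "complex_vector.independent B"
    using assms by (auto simp: cdim_at_least_def)
  have "\<not> B \<subseteq> complex_vector.span {a, b}"
  proof
    assume "B \<subseteq> complex_vector.span {a, b}"
    then have "card B \<le> card {a, b}"
      using complex_vector.independent_span_bound[OF _ B(3)] by simp
    also have "card {a, b} \<le> 2"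
      by (simp add: card_insert_if)
    finally show False using B(2) by simp
  qed
  then obtain x where x: "x \<notin> complex_vector.span {a, b}" by blast
  obtain \<alpha> \<beta> z where z: "x = \<alpha> *\<^sub>C a + \<beta> *\<^sub>C b + z" "cinner a z = 0" "cinner b z = 0"
    by (rule orthogonal_decomposition2)
  have "\<alpha> *\<^sub>C a + \<beta> *\<^sub>C b \<in> complex_vector.span {a, b}"
    by (intro complex_vector.span_add complex_vector.span_scale complex_vector.span_base) auto
  with x z(1) have "z \<noteq> 0" by auto
  with z show ?thesis by blast
qed

section \<open>Strong BJ isomorphisms\<close>

text \<open>
  The ray of \<open>\<omega>\<close> is the image of the ray of \<open>\<zeta>\<close> when hyperplanes are identified with the rays
  orthogonal to them.
\<close>

definition ray_rel :: "(('a::chilbert_space \<Rightarrow>\<^sub>L 'a) \<Rightarrow> ('a \<Rightarrow>\<^sub>L 'a)) \<Rightarrow> 'a \<Rightarrow> 'a \<Rightarrow> bool" where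
  "ray_rel \<Phi> \<zeta> \<omega> \<longleftrightarrow> \<omega> \<noteq> 0 \<and> ker_adj (\<Phi> (rank_one \<zeta> \<zeta>)) = {w. cinner \<omega> w = 0}"

text \<open>
  Rank-one operators test membership of single vectors in the kernels, so strong orthogonality
  determines the inclusion order of the kernels.
\<close>

lemma ker_adj_subset_iff_strong_BJ:
  fixes y z :: "'a::chilbert_space \<Rightarrow>\<^sub>L 'a"
  assumes y: "y \<in> compact_ops" and z: "z \<in> compact_ops"
  shows "ker_adj y \<subseteq> ker_adj z \<longleftrightarrow>
    (\<forall>x\<in>compact_ops. strong_BJ compact_ops x y \<longrightarrow> strong_BJ compact_ops x z)"
proof
  assume "ker_adj y \<subseteq> ker_adj z"
  then show "\<forall>x\<in>compact_ops. strong_BJ compact_ops x y \<longrightarrow> strong_BJ compact_ops x z"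
    using strong_BJ_compact_iff[OF _ y] strong_BJ_compact_iff[OF _ z] by blast
next
  assume R: "\<forall>x\<in>compact_ops. strong_BJ compact_ops x y \<longrightarrow> strong_BJ compact_ops x z"
  show "ker_adj y \<subseteq> ker_adj z"
  proof
    fix \<zeta> assume \<zeta>: "\<zeta> \<in> ker_adj y"
    show "\<zeta> \<in> ker_adj z"
    proof (cases "\<zeta> = 0")
      case False
      then show ?thesis
        using R \<zeta> strong_BJ_hyperplane[OF rank_one_compact y False ker_adj_rank_one[OF False]]
          strong_BJ_hyperplane[OF rank_one_compact z False ker_adj_rank_one[OF False]]
          rank_one_compact by blast
    qed (simp add: ker_op_def)
  qed
qed

lemma ker_adj_eq_UNIV_iff:
  fixes y :: "'a::chilbert_space \<Rightarrow>\<^sub>L 'a"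
  assumes y: "y \<in> bounded_ops"
  shows "ker_adj y = UNIV \<longleftrightarrow> y = 0"
proof
  assume "ker_adj y = UNIV"
  then have "cinner (y u) (y u) = 0" for u
    using ker_adj_iff[OF y] by blast
  then show "y = 0"
    by (intro blinfun_eqI) simp
qed (use ker_adj_iff[OF bounded_ops_zero] in auto)

locale strong_BJ_iso =
  fixes \<Phi> :: "('a::chilbert_space \<Rightarrow>\<^sub>L 'a) \<Rightarrow> ('a \<Rightarrow>\<^sub>L 'a)"
  assumes iso: "strong_BJ_isomorphism compact_ops compact_ops \<Phi>"
begin

lemma bij: "bij_betw \<Phi> compact_ops compact_ops"
  using iso by (simp add: strong_BJ_isomorphism_def)

lemma compact_image: "x \<in> compact_ops \<Longrightarrow> \<Phi> x \<in> compact_ops"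
  using bij by (auto simp: bij_betw_def)

lemma compact_preimage:
  assumes "y \<in> compact_ops"
  obtains x where "x \<in> compact_ops" "y = \<Phi> x"
  using bij assms by (auto simp: bij_betw_def)

lemma strong_BJ_image:
  "x \<in> compact_ops \<Longrightarrow> y \<in> compact_ops \<Longrightarrow>
    strong_BJ compact_ops (\<Phi> x) (\<Phi> y) \<longleftrightarrow> strong_BJ compact_ops x y"
  using iso by (simp add: strong_BJ_isomorphism_def)

lemma ker_adj_subset_image:
  assumes y: "y \<in> compact_ops" and z: "z \<in> compact_ops"
  shows "ker_adj (\<Phi> y) \<subseteq> ker_adj (\<Phi> z) \<longleftrightarrow> ker_adj y \<subseteq> ker_adj z"
proof -
  have "(\<forall>x\<in>compact_ops. strong_BJ compact_ops x (\<Phi> y) \<longrightarrow> strong_BJ compact_ops x (\<Phi> z)) \<longleftrightarrow>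
      (\<forall>x\<in>compact_ops. strong_BJ compact_ops (\<Phi> x) (\<Phi> y) \<longrightarrow> strong_BJ compact_ops (\<Phi> x) (\<Phi> z))"
    by (metis compact_image compact_preimage)
  then show ?thesis
    using y z by (simp add: ker_adj_subset_iff_strong_BJ compact_image strong_BJ_image)
qed

text \<open>
  The zero operator is characterised by having the greatest kernel.
\<close>

lemma image_zero_iff:
  assumes x: "x \<in> compact_ops"
  shows "\<Phi> x = 0 \<longleftrightarrow> x = 0"
proof -
  have max: "ker_adj z = UNIV \<longleftrightarrow> (\<forall>y\<in>compact_ops. ker_adj y \<subseteq> ker_adj z)"
    for z :: "'a \<Rightarrow>\<^sub>L 'a"
    using zero_in_compact_ops ker_adj_eq_UNIV_iff[OF bounded_ops_zero] by blast
  have "ker_adj (\<Phi> x) = UNIV \<longleftrightarrow> (\<forall>y\<in>compact_ops. ker_adj (\<Phi> y) \<subseteq> ker_adj (\<Phi> x))"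
    unfolding max by (metis compact_image compact_preimage)
  also have "\<dots> \<longleftrightarrow> ker_adj x = UNIV"
    unfolding max using x by (simp add: ker_adj_subset_image)
  finally show ?thesis
    using x by (simp add: ker_adj_eq_UNIV_iff compact_ops_bounded compact_image)
qed

text \<open>
  Any nonzero \<open>\<omega>\<close> in the range of \<open>\<Phi> (rank_one \<zeta> \<zeta>)\<close> works. Its orthogonal complement contains the
  kernel in question and is itself the kernel of some \<open>\<Phi> w\<close>. Pulling the inclusion back, \<open>K(w)\<close> is a
  proper subspace that contains the hyperplane orthogonal to \<open>\<zeta>\<close>, so it equals that hyperplane, and the
  inclusion is an equality.
\<close>

lemma ray_exists:
  assumes \<zeta>: "\<zeta> \<noteq> 0"
  shows "\<exists>\<omega>. ray_rel \<Phi> \<zeta> \<omega>"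
proof -
  let ?r = "rank_one \<zeta> \<zeta>"
  have ker_r: "ker_adj ?r = {w. cinner \<zeta> w = 0}"
    by (rule ker_adj_rank_one[OF \<zeta>])
  then have "ker_adj ?r \<noteq> UNIV"
    using \<zeta> cinner_self_eq_0_iff[of \<zeta>] by blast
  then have "?r \<noteq> 0"
    by (simp add: ker_adj_eq_UNIV_iff rank_one_bounded)
  then have "\<Phi> ?r \<noteq> 0"
    by (simp add: image_zero_iff rank_one_compact)
  then obtain u where u: "\<Phi> ?r u \<noteq> 0"
    by (metis blinfun_eqI zero_blinfun.rep_eq)
  define \<omega> where "\<omega> = \<Phi> ?r u"
  have \<omega>: "\<omega> \<noteq> 0" using u by (simp add: \<omega>_def)
  have \<Phi>r: "\<Phi> ?r \<in> compact_ops" by (simp add: compact_image rank_one_compact)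
  obtain w where w: "w \<in> compact_ops" "rank_one \<omega> \<omega> = \<Phi> w"
    by (rule compact_preimage[OF rank_one_compact])
  have ker_w: "ker_adj (\<Phi> w) = {v. cinner \<omega> v = 0}"
    using ker_adj_rank_one[OF \<omega>, of \<omega>] w(2) by simp
  have "ker_adj (\<Phi> ?r) \<subseteq> ker_adj (\<Phi> w)"
    unfolding ker_w \<omega>_def using ker_adj_iff[OF compact_ops_bounded[OF \<Phi>r]] by blast
  then have sub: "ker_adj ?r \<subseteq> ker_adj w"
    by (simp add: ker_adj_subset_image rank_one_compact w(1))
  have "ker_adj w \<subseteq> ker_adj ?r"
  proof
    fix v assume v: "v \<in> ker_adj w"
    obtain c z where cz: "v = c *\<^sub>C \<zeta> + z" "cinner \<zeta> z = 0"
      by (rule orthogonal_decomposition)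
    note wb = compact_ops_bounded[OF w(1)]
    have z: "z \<in> ker_adj w" using sub ker_r cz(2) by blast
    have "c = 0"
    proof (rule ccontr)
      assume "c \<noteq> 0"
      have "c *\<^sub>C \<zeta> \<in> ker_adj w"
        using v z by (simp add: cz(1) ker_adj_iff[OF wb] cinner_add_right)
      then have "(1 / c) *\<^sub>C c *\<^sub>C \<zeta> \<in> ker_adj w"
        by (rule ker_adj_scaleC[OF wb])
      then have \<zeta>w: "\<zeta> \<in> ker_adj w"
        using \<open>c \<noteq> 0\<close> by (simp add: scaleC_scaleC scaleC_one)
      have "x \<in> ker_adj w" for x
      proof -
        obtain d y where dy: "x = d *\<^sub>C \<zeta> + y" "cinner \<zeta> y = 0"
          by (rule orthogonal_decomposition)
        have "y \<in> ker_adj w" using sub ker_r dy(2) by blast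
        with \<zeta>w show ?thesis
          by (simp add: dy(1) ker_adj_iff[OF wb] cinner_simps)
      qed
      then have "ker_adj w = UNIV" by blast
      then have "w = 0" by (simp add: ker_adj_eq_UNIV_iff[OF wb])
      then have "\<Phi> w = 0" by (simp add: image_zero_iff zero_in_compact_ops)
      then have "ker_adj (\<Phi> w) = UNIV"
        by (simp add: ker_adj_eq_UNIV_iff bounded_ops_zero)
      then show False
        using ker_w \<omega> cinner_self_eq_0_iff[of \<omega>] by blast
    qed
    with cz show "v \<in> ker_adj ?r" by (simp add: ker_r)
  qed
  with sub have "ker_adj (\<Phi> ?r) = ker_adj (\<Phi> w)"
    using ker_adj_subset_image[OF rank_one_compact w(1)] ker_adj_subset_image[OF w(1) rank_one_compact]
    by blast
  then show ?thesis
    using \<omega> ker_w by (auto simp: ray_rel_def)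
qed

definition ray_map :: "'a \<Rightarrow> 'a" where
  "ray_map \<zeta> = (if \<zeta> = 0 then 0 else SOME \<omega>. ray_rel \<Phi> \<zeta> \<omega>)"

lemma ray_map:
  assumes "\<zeta> \<noteq> 0"
  shows "ray_map \<zeta> \<noteq> 0"
    and "ker_adj (\<Phi> (rank_one \<zeta> \<zeta>)) = {w. cinner (ray_map \<zeta>) w = 0}"
proof -
  have "ray_rel \<Phi> \<zeta> (ray_map \<zeta>)"
    using someI_ex[OF ray_exists[OF assms]] assms by (simp add: ray_map_def)
  then show "ray_map \<zeta> \<noteq> 0" "ker_adj (\<Phi> (rank_one \<zeta> \<zeta>)) = {w. cinner (ray_map \<zeta>) w = 0}"
    by (simp_all add: ray_rel_def)
qed

lemma ker_adj_image:
  assumes y: "y \<in> compact_ops"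
  shows "ray_map \<zeta> \<in> ker_adj (\<Phi> y) \<longleftrightarrow> \<zeta> \<in> ker_adj y"
proof (cases "\<zeta> = 0")
  case True
  then show ?thesis by (simp add: ray_map_def ker_op_def)
next
  case False
  have "ray_map \<zeta> \<in> ker_adj (\<Phi> y) \<longleftrightarrow> strong_BJ compact_ops (\<Phi> (rank_one \<zeta> \<zeta>)) (\<Phi> y)"
    by (rule strong_BJ_hyperplane[symmetric, OF compact_image[OF rank_one_compact] compact_image[OF y]
          ray_map(1)[OF False] ray_map(2)[OF False]])
  also have "\<dots> \<longleftrightarrow> strong_BJ compact_ops (rank_one \<zeta> \<zeta>) y"
    by (rule strong_BJ_image[OF rank_one_compact y])
  also have "\<dots> \<longleftrightarrow> \<zeta> \<in> ker_adj y"
    by (rule strong_BJ_hyperplane[OF rank_one_compact y False ker_adj_rank_one[OF False]])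
  finally show ?thesis .
qed

lemma ray_map_orth: "cinner (ray_map x) (ray_map y) = 0 \<longleftrightarrow> cinner x y = 0"
proof (cases "x = 0")
  case True
  then show ?thesis by (simp add: ray_map_def)
next
  case False
  have "cinner (ray_map x) (ray_map y) = 0 \<longleftrightarrow> ray_map y \<in> ker_adj (\<Phi> (rank_one x x))"
    by (simp add: ray_map(2)[OF False])
  also have "\<dots> \<longleftrightarrow> y \<in> ker_adj (rank_one x x)"
    by (rule ker_adj_image[OF rank_one_compact])
  finally show ?thesis by (simp add: ker_adj_rank_one[OF False])
qed

lemma inverse_iso: "strong_BJ_iso (inv_into compact_ops \<Phi>)"
proof
  let ?\<Psi> = "inv_into compact_ops \<Phi>"
  have "bij_betw ?\<Psi> compact_ops compact_ops"
    by (rule bij_betw_inv_into[OF bij])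
  moreover have "strong_BJ compact_ops x y \<longleftrightarrow> strong_BJ compact_ops (?\<Psi> x) (?\<Psi> y)"
    if "x \<in> compact_ops" "y \<in> compact_ops" for x y
  proof -
    have "\<Phi> (?\<Psi> x) = x" "\<Phi> (?\<Psi> y) = y" "?\<Psi> x \<in> compact_ops" "?\<Psi> y \<in> compact_ops"
      using bij that by (auto simp: bij_betw_def f_inv_into_f inv_into_into)
    then show ?thesis using strong_BJ_image[of "?\<Psi> x" "?\<Psi> y"] by simp
  qed
  ultimately show "strong_BJ_isomorphism compact_ops compact_ops ?\<Psi>"
    by (simp add: strong_BJ_isomorphism_def)
qed

text \<open>
  The inverse of \<open>\<Phi>\<close> satisfies the same hypothesis; its ray map supplies the preimage.
\<close>

lemma ray_map_surj: "\<exists>\<zeta> c. \<omega> = c *\<^sub>C ray_map \<zeta>"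
proof (cases "\<omega> = 0")
  case True
  then show ?thesis by (intro exI[of _ 0]) simp
next
  case False
  interpret inv: strong_BJ_iso "inv_into compact_ops \<Phi>" by (rule inverse_iso)
  let ?w = "inv_into compact_ops \<Phi> (rank_one \<omega> \<omega>)"
  have w: "?w \<in> compact_ops" by (simp add: inv.compact_image rank_one_compact)
  have \<Phi>w: "\<Phi> ?w = rank_one \<omega> \<omega>"
    using bij rank_one_compact[of \<omega> \<omega>] by (auto simp: bij_betw_def f_inv_into_f)
  define \<zeta> where "\<zeta> = inv.ray_map \<omega>"
  have \<zeta>: "\<zeta> \<noteq> 0" "ker_adj ?w = {v. cinner \<zeta> v = 0}"
    unfolding \<zeta>_def by (rule inv.ray_map[OF False])+
  then have "ker_adj ?w = ker_adj (rank_one \<zeta> \<zeta>)"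
    by (simp add: ker_adj_rank_one)
  then have "ker_adj (\<Phi> ?w) = ker_adj (\<Phi> (rank_one \<zeta> \<zeta>))"
    using ker_adj_subset_image[OF rank_one_compact w] ker_adj_subset_image[OF w rank_one_compact]
    by blast
  then have eq: "{v. cinner \<omega> v = 0} = {v. cinner (ray_map \<zeta>) v = 0}"
    by (simp add: \<Phi>w ker_adj_rank_one[OF False] ray_map(2)[OF \<zeta>(1)])
  obtain c z where cz: "\<omega> = c *\<^sub>C ray_map \<zeta> + z" "cinner (ray_map \<zeta>) z = 0"
    by (rule orthogonal_decomposition)
  then have "cinner \<omega> z = 0" using eq by blast
  with cz have "z = 0" by (simp add: cinner_simps)
  with cz show ?thesis by auto
qed

text \<open>
  By \<open>attain_adj_iff_strong_BJ\<close> the norm-attaining vectors are determined by data that \<open>\<Phi>\<close> and \<open>V\<close>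
  respect. That description is for nonzero operators and vectors; the zero cases are immediate.
\<close>

lemma attain_adj_transport:
  assumes V: "bij V" "V 0 = 0" and x: "x \<in> compact_ops"
    and ker: "\<And>y \<zeta>. y \<in> compact_ops \<Longrightarrow> V \<zeta> \<in> ker_adj (\<Phi> y) \<longleftrightarrow> \<zeta> \<in> ker_adj y"
  shows "V \<zeta> \<in> attain_adj (\<Phi> x) \<longleftrightarrow> \<zeta> \<in> attain_adj x"
proof -
  consider "x = 0" | "\<zeta> = 0" | "x \<noteq> 0" "\<zeta> \<noteq> 0" by blast
  then show ?thesis
  proof cases
    case 1
    then have "\<Phi> x = 0" by (simp add: image_zero_iff zero_in_compact_ops)
    with 1 show ?thesis
      by (simp add: attain_adj_iff bounded_ops_zero)
  next
    case 2
    then show ?thesis by (simp add: norm_attaining_def V)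
  next
    case 3
    have "V \<zeta> \<noteq> 0" using 3(2) V by (metis bij_pointE)
    moreover have "\<Phi> x \<noteq> 0" using 3(1) by (simp add: image_zero_iff x)
    ultimately have "V \<zeta> \<in> attain_adj (\<Phi> x) \<longleftrightarrow>
        (\<forall>y\<in>compact_ops. V \<zeta> \<in> ker_adj y \<longrightarrow> strong_BJ compact_ops (\<Phi> x) y)"
      by (intro attain_adj_iff_strong_BJ compact_image x)
    also have "\<dots> \<longleftrightarrow> (\<forall>y\<in>compact_ops. V \<zeta> \<in> ker_adj (\<Phi> y) \<longrightarrow> strong_BJ compact_ops (\<Phi> x) (\<Phi> y))"
      by (metis compact_image compact_preimage)
    also have "\<dots> \<longleftrightarrow> (\<forall>y\<in>compact_ops. \<zeta> \<in> ker_adj y \<longrightarrow> strong_BJ compact_ops x y)"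
      using x by (simp add: ker strong_BJ_image)
    also have "\<dots> \<longleftrightarrow> \<zeta> \<in> attain_adj x"
      by (rule attain_adj_iff_strong_BJ[symmetric, OF x 3])
    finally show ?thesis .
  qed
qed

end

lemma image_eq_of_bij:
  assumes "bij U" "\<And>x. U x \<in> B \<longleftrightarrow> x \<in> A"
  shows "B = U ` A"
  using assms by (metis bij_is_surj image_eqI subsetI set_eq_iff surj_image_vimage_eq vimage_eq)

lemma unitary_or_antiunitary_basic:
  assumes "unitary_op U \<or> antiunitary_op U"
  shows "bij U" "U 0 = 0"
proof -
  show "bij U" using assms by (auto simp: unitary_op_def antiunitary_op_def)
  have "U (0 + 0) = U 0 + U 0"
    using assms unfolding unitary_op_def antiunitary_op_def conj_linear_def Vector_Spaces.linear_iff
    by metis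
  then show "U 0 = 0" by simp
qed

lemma strong_BJ_isomorphism_if_subspaces:
  fixes \<Phi> :: "('a::chilbert_space \<Rightarrow>\<^sub>L 'a) \<Rightarrow> ('a \<Rightarrow>\<^sub>L 'a)"
  assumes \<Phi>: "bij_betw \<Phi> compact_ops compact_ops" and U: "bij U" "U 0 = 0"
    and subspaces: "\<And>A. A \<in> compact_ops \<Longrightarrow>
      attain_adj (\<Phi> A) = U ` attain_adj A \<and> ker_adj (\<Phi> A) = U ` ker_adj A"
  shows "strong_BJ_isomorphism compact_ops compact_ops \<Phi>"
  unfolding strong_BJ_isomorphism_def
proof (intro conjI ballI \<Phi>)
  fix x y :: "'a \<Rightarrow>\<^sub>L 'a" assume x: "x \<in> compact_ops" and y: "y \<in> compact_ops"
  have \<Phi>x: "\<Phi> x \<in> compact_ops" and \<Phi>y: "\<Phi> y \<in> compact_ops"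
    using \<Phi> x y by (auto simp: bij_betw_def)
  have "\<Phi> x = 0 \<longleftrightarrow> U ` ker_adj x = UNIV"
    using subspaces[OF x] ker_adj_eq_UNIV_iff[OF compact_ops_bounded[OF \<Phi>x]] by simp
  also have "\<dots> \<longleftrightarrow> ker_adj x = UNIV"
    using U(1) by (metis bij_def inj_image_eq_iff)
  finally have zero: "\<Phi> x = 0 \<longleftrightarrow> x = 0"
    by (simp add: ker_adj_eq_UNIV_iff[OF compact_ops_bounded[OF x]])
  have nonzero: "U \<xi> \<noteq> 0 \<longleftrightarrow> \<xi> \<noteq> 0" for \<xi>
    using U by (metis bij_is_inj inj_eq)
  have "(\<exists>\<xi>. \<xi> \<noteq> 0 \<and> \<xi> \<in> U ` attain_adj x \<and> \<xi> \<in> U ` ker_adj y) \<longleftrightarrow>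
      (\<exists>\<xi>. U \<xi> \<noteq> 0 \<and> U \<xi> \<in> U ` attain_adj x \<and> U \<xi> \<in> U ` ker_adj y)"
    using bij_is_surj[OF U(1)] by blast
  also have "\<dots> \<longleftrightarrow> (\<exists>\<xi>. \<xi> \<noteq> 0 \<and> \<xi> \<in> attain_adj x \<and> \<xi> \<in> ker_adj y)"
    by (simp only: nonzero inj_image_mem_iff[OF bij_is_inj[OF U(1)]])
  finally show "strong_BJ compact_ops x y \<longleftrightarrow> strong_BJ compact_ops (\<Phi> x) (\<Phi> y)"
    by (simp add: strong_BJ_compact_iff[OF x y] strong_BJ_compact_iff[OF \<Phi>x \<Phi>y] zero
        subspaces x y)
qed

theorem theorem3p27:
  fixes \<Phi> :: "('a::chilbert_space \<Rightarrow>\<^sub>L 'a) \<Rightarrow> ('a \<Rightarrow>\<^sub>L 'a)"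
  assumes "cdim_at_least 3 TYPE('a)"
    and "bij_betw \<Phi> compact_ops compact_ops"
  shows "strong_BJ_isomorphism compact_ops compact_ops \<Phi> \<longleftrightarrow>
    (\<exists>U. (unitary_op U \<or> antiunitary_op U) \<and>
      (\<forall>A\<in>compact_ops.
         norm_attaining (abs_op (adj_op (\<Phi> A))) = U ` norm_attaining (abs_op (adj_op A)) \<and>
         ker_op (abs_op (adj_op (\<Phi> A))) = U ` ker_op (abs_op (adj_op A))))"
    (is "?L \<longleftrightarrow> (\<exists>U. ?unitary U \<and> ?subspaces U)")
proof -
  have subspaces_iff: "?subspaces U \<longleftrightarrow>
      (\<forall>A\<in>compact_ops. attain_adj (\<Phi> A) = U ` attain_adj A \<and> ker_adj (\<Phi> A) = U ` ker_adj A)" for U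
  proof (intro ball_cong refl)
    fix A :: "'a \<Rightarrow>\<^sub>L 'a" assume "A \<in> compact_ops"
    then have "A \<in> bounded_ops" "\<Phi> A \<in> bounded_ops"
      using assms(2) by (auto simp: bij_betw_def intro: compact_ops_bounded)
    then show "(norm_attaining (abs_op (adj_op (\<Phi> A))) = U ` norm_attaining (abs_op (adj_op A)) \<and>
         ker_op (abs_op (adj_op (\<Phi> A))) = U ` ker_op (abs_op (adj_op A))) \<longleftrightarrow>
       (attain_adj (\<Phi> A) = U ` attain_adj A \<and> ker_adj (\<Phi> A) = U ` ker_adj A)"
      by (simp add: norm_attaining_abs_adj)
  qed
  show ?thesis
    unfolding subspaces_iff
  proof
    assume ?L
    then interpret strong_BJ_iso \<Phi> by unfold_locales
    interpret orthogonality_ray_map ray_map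
      by unfold_locales (intro ray_map_orth ray_map_surj room_of_cdim[OF assms(1)])+
    obtain U where U: "?unitary U" and multiple: "\<And>x. \<exists>k. k \<noteq> 0 \<and> U x = k *\<^sub>C ray_map x"
      using uhlhorn by blast
    note U' = unitary_or_antiunitary_basic[OF U]
    have ker: "U \<zeta> \<in> ker_adj (\<Phi> y) \<longleftrightarrow> \<zeta> \<in> ker_adj y" if y: "y \<in> compact_ops" for y \<zeta>
    proof -
      obtain k where k: "k \<noteq> 0" "U \<zeta> = k *\<^sub>C ray_map \<zeta>" using multiple by blast
      then have "U \<zeta> \<in> ker_adj (\<Phi> y) \<longleftrightarrow> ray_map \<zeta> \<in> ker_adj (\<Phi> y)"
        by (simp add: ker_adj_iff compact_ops_bounded compact_image y cinner_simps)
      then show ?thesis by (simp add: ker_adj_image[OF y])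
    qed
    have "attain_adj (\<Phi> A) = U ` attain_adj A \<and> ker_adj (\<Phi> A) = U ` ker_adj A"
      if A: "A \<in> compact_ops" for A
      using attain_adj_transport[OF U' A ker] ker[OF A] by (intro conjI image_eq_of_bij U'(1)) blast+
    with U show "\<exists>U. ?unitary U \<and> (\<forall>A\<in>compact_ops.
        attain_adj (\<Phi> A) = U ` attain_adj A \<and> ker_adj (\<Phi> A) = U ` ker_adj A)"
      by blast
  next
    assume "\<exists>U. ?unitary U \<and> (\<forall>A\<in>compact_ops.
        attain_adj (\<Phi> A) = U ` attain_adj A \<and> ker_adj (\<Phi> A) = U ` ker_adj A)"
    then obtain U where U: "?unitary U" and subspaces: "\<forall>A\<in>compact_ops.
        attain_adj (\<Phi> A) = U ` attain_adj A \<and> ker_adj (\<Phi> A) = U ` ker_adj A"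
      by blast
    show ?L
      by (rule strong_BJ_isomorphism_if_subspaces[OF assms(2) unitary_or_antiunitary_basic[OF U]])
        (use subspaces in blast)
  qed
qed

end
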